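(* Let $L_\varphi$ be the set of all $\alpha\in\mathbb{R}$ such that $E(\alpha)\neq\emptyset$. Then $$L_{\varphi}=[P'_{\varphi}(-\infty),P'_{\varphi}(+\infty)].$$ Moreover, if $\alpha=P'_{\varphi}(s_\alpha)$ for some $s_\alpha\in\mathbb{R}\cup\{-\infty,+\infty\}$, then $E(\alpha)\neq\emptyset$ and the Hausdorff dimension of $E(\alpha)$ is $$\dim_H E(\alpha)=\frac{P_{\varphi}^*(\alpha)}{q^{\ell-1}\log m}.$$
   Context: Let $m\ge 2$, $\ell\ge 2$, $q\ge 2$ be integers, $S=\{0,1,\dots,m-1\}$, and let $\Sigma_m$ be the space of sequences $x=(x_n)_{n\ge1}$ with $x_n\in S$, with the standard metric $d(x,y)=m^{-\min\{n\ge 0:\,x_{n+1}\ne y_{n+1}\}}$ for $x\neq y$. Let $\varphi:S^\ell\to\mathbb{R}$ be a function with $\alpha_{\min}<\alpha_{\max}$, where $\alpha_{\min}=\min_{S^\ell}\varphi$ and $\alpha_{\max}=\max_{S^\ell}\varphi$. For $\alpha\in\mathbb{R}$, $$E(\alpha)=\Big\{x\in\Sigma_m:\ \lim_{n\to\infty}\frac1n\sum_{k=1}^n\varphi(x_k,x_{kq},\dots,x_{kq^{\ell-1}})=\alpha\Big\}.$$ For $s\in\mathbb{R}$ let $\psi_s:S^{\ell-1}\to(0,\infty)$ be the unique strictly positive function satisfying $$\psi_s(a_1,\dots,a_{\ell-1})^q=\sum_{j\in S}e^{s\varphi(a_1,\dots,a_{\ell-1},j)}\,\psi_s(a_2,\dots,a_{\ell-1},j)\qquad\text{for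 all }(a_1,\dots,a_{\ell-1})\in S^{\ell-1}.$$ Extend $\psi_s$ to $S^k$ for $1\le k\le \ell-2$, downwards in $k$, by $\psi_s(a)=\big(\sum_{j\in S}\psi_s(a,j)\big)^{1/q}$ for $a\in S^k$. The pressure function is $$P_\varphi(s)=(q-1)q^{\ell-2}\log\sum_{j\in S}\psi_s(j)\qquad(s\in\mathbb{R}),$$ where $\log$ is the natural logarithm; it is an analytic convex function on $\mathbb{R}$. Set $P'_\varphi(\pm\infty)=\lim_{s\to\pm\infty}P'_\varphi(s)$ and $P^*_\varphi(\alpha)=\inf_{s\in\mathbb{R}}(-s\alpha+P_\varphi(s))$. *)

theory Defs
  imports "HOL-Analysis.Analysis"
begin

section \<open>Hausdorff dimension in a metric space given by a carrier and a distance\<close>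

definition ediam :: "('a \<Rightarrow> 'a \<Rightarrow> real) \<Rightarrow> 'a set \<Rightarrow> ennreal" where
  "ediam d U = (SUP x\<in>U. SUP y\<in>U. ennreal (d x y))"

text \<open>The \<open>t\<close>-th power of the diameter of a set of finite diameter. Since \<^term>\<open>0 powr 0 = (0::real)\<close>,
  the case \<open>t = 0\<close> is spelled out, so that a nonempty set always has weight 1 there.\<close>

definition diam_weight :: "('a \<Rightarrow> 'a \<Rightarrow> real) \<Rightarrow> real \<Rightarrow> 'a set \<Rightarrow> ennreal" where
  "diam_weight d t U =
     (if U = {} then 0 else if t = 0 then 1 else ennreal (enn2real (ediam d U) powr t))"

definition hausdorff_premeasure ::
  "'a set \<Rightarrow> ('a \<Rightarrow> 'a \<Rightarrow> real) \<Rightarrow> real \<Rightarrow> real \<Rightarrow> 'a set \<Rightarrow> ennreal" where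
  "hausdorff_premeasure M d t \<delta> A =
     (INF U \<in> {U :: nat \<Rightarrow> 'a set.
                 (\<forall>i. U i \<subseteq> M \<and> ediam d (U i) \<le> ennreal \<delta>) \<and> A \<subseteq> (\<Union>i. U i)}.
        \<Sum>i. diam_weight d t (U i))"

definition hausdorff_measure ::
  "'a set \<Rightarrow> ('a \<Rightarrow> 'a \<Rightarrow> real) \<Rightarrow> real \<Rightarrow> 'a set \<Rightarrow> ennreal" where
  "hausdorff_measure M d t A = (SUP \<delta>\<in>{0<..}. hausdorff_premeasure M d t \<delta> A)"

definition hausdorff_dim :: "'a set \<Rightarrow> ('a \<Rightarrow> 'a \<Rightarrow> real) \<Rightarrow> 'a set \<Rightarrow> ereal" where
  "hausdorff_dim M d A = (INF t \<in> {t. 0 \<le> t \<and> hausdorff_measure M d t A = 0}. ereal t)"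


section \<open>The symbolic space and the level sets\<close>

text \<open>Sequences are indexed by \<open>{1..}\<close>, as required by the multiplicative indices \<open>k * q ^ i\<close>;
  the value at the unused index \<open>0\<close> is pinned to \<^term>\<open>undefined\<close> by extensionality.\<close>

definition seq_space :: "nat \<Rightarrow> (nat \<Rightarrow> nat) set" where
  "seq_space m = ({1..} \<rightarrow>\<^sub>E {..<m})"

definition seq_dist :: "nat \<Rightarrow> (nat \<Rightarrow> nat) \<Rightarrow> (nat \<Rightarrow> nat) \<Rightarrow> real" where
  "seq_dist m x y = (if x = y then 0 else 1 / real m ^ (LEAST n. x (n + 1) \<noteq> y (n + 1)))"

definition words :: "nat \<Rightarrow> nat \<Rightarrow> nat list set" where
  "words m k = {a. set a \<subseteq> {..<m} \<and> length a = k}"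

definition level_set :: "nat \<Rightarrow> nat \<Rightarrow> nat \<Rightarrow> (nat list \<Rightarrow> real) \<Rightarrow> real \<Rightarrow> (nat \<Rightarrow> nat) set" where
  "level_set m l q \<phi> \<alpha> =
     {x \<in> seq_space m.
        (\<lambda>n. 1 / real n * (\<Sum>k=1..n. \<phi> (map (\<lambda>i. x (k * q ^ i)) [0..<l]))) \<longlonglongrightarrow> \<alpha>}"


section \<open>The pressure function\<close>

text \<open>Extensionality is what makes \<open>\<psi>\<close>, as a function on words of length \<open>l - 1\<close>, unique.\<close>

definition psi_base :: "nat \<Rightarrow> nat \<Rightarrow> nat \<Rightarrow> (nat list \<Rightarrow> real) \<Rightarrow> real \<Rightarrow> nat list \<Rightarrow> real" where
  "psi_base m l q \<phi> s =
     (THE \<psi>. \<psi> \<in> extensional (words m (l - 1)) \<and>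
             (\<forall>a\<in>words m (l - 1). 0 < \<psi> a) \<and>
             (\<forall>a\<in>words m (l - 1).
                \<psi> a ^ q = (\<Sum>j<m. exp (s * \<phi> (a @ [j])) * \<psi> (tl a @ [j]))))"

text \<open>\<open>psi_ext \<dots> d\<close> is the extension to words of length \<open>l - 1 - d\<close>.\<close>

primrec psi_ext ::
  "nat \<Rightarrow> nat \<Rightarrow> nat \<Rightarrow> (nat list \<Rightarrow> real) \<Rightarrow> real \<Rightarrow> nat \<Rightarrow> nat list \<Rightarrow> real" where
  "psi_ext m l q \<phi> s 0 a = psi_base m l q \<phi> s a"
| "psi_ext m l q \<phi> s (Suc d) a = root q (\<Sum>j<m. psi_ext m l q \<phi> s d (a @ [j]))"

definition psi :: "nat \<Rightarrow> nat \<Rightarrow> nat \<Rightarrow> (nat list \<Rightarrow> real) \<Rightarrow> real \<Rightarrow> nat list \<Rightarrow> real" where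
  "psi m l q \<phi> s a = psi_ext m l q \<phi> s (l - 1 - length a) a"

definition pressure :: "nat \<Rightarrow> nat \<Rightarrow> nat \<Rightarrow> (nat list \<Rightarrow> real) \<Rightarrow> real \<Rightarrow> real" where
  "pressure m l q \<phi> s = real (q - 1) * real q ^ (l - 2) * ln (\<Sum>j<m. psi m l q \<phi> s [j])"

definition pressure_deriv :: "nat \<Rightarrow> nat \<Rightarrow> nat \<Rightarrow> (nat list \<Rightarrow> real) \<Rightarrow> ereal \<Rightarrow> real" where
  "pressure_deriv m l q \<phi> s =
     (case s of
        ereal r \<Rightarrow> deriv (pressure m l q \<phi>) r
      | PInfty \<Rightarrow> Lim at_top (deriv (pressure m l q \<phi>))
      | MInfty \<Rightarrow> Lim at_bot (deriv (pressure m l q \<phi>)))"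

text \<open>The infimum is taken in \<^typ>\<open>ereal\<close>, because it is \<open>-\<infinity>\<close> for some \<open>\<alpha>\<close>.\<close>

definition pressure_conj :: "nat \<Rightarrow> nat \<Rightarrow> nat \<Rightarrow> (nat list \<Rightarrow> real) \<Rightarrow> real \<Rightarrow> ereal" where
  "pressure_conj m l q \<phi> \<alpha> = (INF s. ereal (- s * \<alpha> + pressure m l q \<phi> s))"

end

theory Submission
  imports Defs
begin

text \<open>The integers \<open>k \<ge> 1\<close> split into the chains \<open>i, i q, i q\<^sup>2, \<dots>\<close> with
\<open>i\<close> not divisible by \<open>q\<close>, and every summand \<open>\<phi> (x\<^sub>k, x\<^sub>k\<^sub>q, \<dots>)\<close> only looks at \<open>l\<close> consecutive
entries of one chain. So let the chains be independent, and let each of them be a Markov chain of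
order \<open>l - 1\<close>: the entry at \<open>k\<close> is drawn according to the at most \<open>l - 1\<close> entries
before it on its chain. Together with the entry itself they form the window at \<open>k\<close>. If \<open>p w\<close> is the
probability of the last letter of the window \<open>w\<close>, the cylinder of \<open>x\<^sub>1 \<dots> x\<^sub>n\<close> has weight
\<open>\<mu> (x\<^sub>1 \<dots> x\<^sub>n) = (\<Prod>k\<le>n. p (window x k))\<close>.

For real \<open>s\<close> take \<open>p w = exp (s \<phi>(w)) \<psi>\<^sub>s(w') / \<psi>\<^sub>s(w'')\<^sup>q\<close>, where \<open>w'\<close> is the past seen by the next entry and
\<open>w''\<close> is \<open>w\<close> without its last letter; the factor with \<open>\<phi>\<close> is only present for windows of full length
\<open>l\<close>, and the extension of \<open>\<psi>\<^sub>s\<close> to shorter words is continued to the empty word. The equations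
defining \<open>\<psi>\<^sub>s\<close> say that these numbers are probabilities. Put
\<open>S n = (\<Sum>k\<le>n. ln \<psi>\<^sub>s(w'\<^sub>k))\<close> with \<open>w\<^sub>k = window x k\<close>. If \<open>q\<^bsup>l-1\<^esup>\<close> divides \<open>n\<close>, taking logarithms gives
\<open>ln \<mu> (x\<^sub>1 \<dots> x\<^sub>n) = s (\<Sum>k\<le>n/q\<^bsup>l-1\<^esup>. \<phi> (x\<^sub>k, x\<^sub>k\<^sub>q, \<dots>)) + (S n - q S (n/q)) - n P(s)/q\<^bsup>l-1\<^esup>\<close>.

\<^item> Upper bound. For \<open>n = q\<^sup>i\<close>, dividing \<open>S n - q S (n/q)\<close> by \<open>n\<close> yields an increment of the bounded sequence
  \<open>S (q\<^sup>i) / q\<^sup>i\<close>, hence infinitely often at least \<open>-e\<close>. So every point of \<open>E(\<alpha>)\<close> has infinitely many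
  prefixes of weight at least \<open>exp (- n ((P(s) - s \<alpha>)/q\<^bsup>l-1\<^esup> + e))\<close> (\<open>heavy_prefixes\<close>); there are few such
  words of each length, which bounds the dimension by \<open>(P(s) - s \<alpha>)/(q\<^bsup>l-1\<^esup> ln m)\<close>.
\<^item> Lower bound. For every kernel \<open>p\<close>, a law of large numbers holds outside a negligible set:
  averages of a function of the window converge to a constant (\<open>typical_average_window\<close>). Applied to
  \<open>\<phi>\<close> and to \<open>- ln p\<close> it shows that some \<open>E(\<alpha>)\<close> is nonempty and has dimension at least the entropy of
  \<open>p\<close> divided by \<open>ln m\<close> (\<open>level_set_of_kernel\<close>).
\<^item> The derivative of the pressure. For the kernel of parameter \<open>s\<close> let \<open>\<alpha>\<^sub>s\<close> be the almost sure limit of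
  the averages that define \<open>E\<close>. Its entropy is \<open>(P(s) - s \<alpha>\<^sub>s)/q\<^bsup>l-1\<^esup>\<close>, and comparing the lower bound of parameter \<open>s\<close> with the
  upper bound of parameter \<open>t\<close> for the same set \<open>E(\<alpha>\<^sub>s)\<close> gives \<open>P(s) - s \<alpha>\<^sub>s \<le> P(t) - t \<alpha>\<^sub>s\<close>. Thus \<open>\<alpha>\<^sub>s\<close> is a
  subgradient of \<open>P\<close> at \<open>s\<close>; as \<open>\<psi>\<^sub>s\<close>, and with it \<open>\<alpha>\<^sub>s\<close>, is continuous in \<open>s\<close>, it follows that \<open>P\<close> is
  differentiable with \<open>P'(s) = \<alpha>\<^sub>s\<close>.
\<^item> The end points. For parameters \<open>s\<^sub>k \<longlonglongrightarrow> \<plusminus>\<infinity>\<close> a subsequence of the kernels converges to a kernel, and both the mean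
  of \<open>\<phi>\<close> and the entropy are continuous in the kernel, so the lower bound passes to the limit
  (\<open>level_set_limit_slope\<close>). Every \<open>\<alpha>\<close> strictly between the end points is some \<open>P'(s)\<close>, as \<open>P'\<close> is
  continuous. No other \<open>\<alpha>\<close> occurs: the weights are at most 1, so a point of
  \<open>E(\<alpha>)\<close> forces \<open>P(s) \<ge> s \<alpha>\<close> for all \<open>s\<close>.

Sets of sequences are measured by covering them with cylinders, so that the probabilistic part of the
argument consists of sums over finite words.\<close>

section \<open>Prefixes and cylinders\<close>

definition seq_prefix :: "(nat \<Rightarrow> nat) \<Rightarrow> nat \<Rightarrow> nat list" where
  "seq_prefix x n = map x [1..<Suc n]"

lemma length_seq_prefix [simp]: "length (seq_prefix x n) = n"
  by (simp add: seq_prefix_def)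

lemma seq_prefix_0 [simp]: "seq_prefix x 0 = []"
  by (simp add: seq_prefix_def)

lemma seq_prefix_Suc: "seq_prefix x (Suc n) = seq_prefix x n @ [x (Suc n)]"
  by (simp add: seq_prefix_def)

lemma seq_prefix_nth: "i < n \<Longrightarrow> seq_prefix x n ! i = x (Suc i)"
  by (simp add: seq_prefix_def del: upt_Suc)

lemma seq_prefix_eq_iff: "seq_prefix x n = seq_prefix y n \<longleftrightarrow> (\<forall>i\<in>{1..n}. x i = y i)"
  by (auto simp: seq_prefix_def)

lemma seq_prefix_in_words: "x \<in> seq_space m \<Longrightarrow> seq_prefix x n \<in> words m n"
  by (auto simp: seq_prefix_def seq_space_def words_def PiE_def Pi_def simp del: upt_Suc)

lemma words_0: "words m 0 = {[]}"
  by (auto simp: words_def)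

lemma finite_words [simp]: "finite (words m n)"
  unfolding words_def by (rule finite_lists_length_eq) simp

lemma sum_words_Suc:
  fixes f :: "nat list \<Rightarrow> 'a::comm_monoid_add"
  shows "(\<Sum>w\<in>words m (Suc n). f w) = (\<Sum>w\<in>words m n. \<Sum>j<m. f (w @ [j]))"
proof -
  have eq: "words m (Suc n) = (\<lambda>(w, j). w @ [j]) ` (words m n \<times> {..<m})"
  proof (intro equalityI subsetI)
    fix w assume w: "w \<in> words m (Suc n)"
    then have "w \<noteq> []" by (auto simp: words_def)
    then have "w = butlast w @ [last w]" by simp
    moreover have "butlast w \<in> words m n" "last w \<in> {..<m}"
      using w \<open>w \<noteq> []\<close> by (auto simp: words_def dest: in_set_butlastD last_in_set)
    ultimately show "w \<in> (\<lambda>(w, j). w @ [j]) ` (words m n \<times> {..<m})"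
      by (metis (mono_tags, lifting) SigmaI case_prod_conv image_eqI)
  qed (auto simp: words_def)
  have "inj_on (\<lambda>(w, j). w @ [j]) (words m n \<times> {..<m})"
    by (auto simp: inj_on_def)
  then show ?thesis
    unfolding eq by (subst sum.reindex) (auto simp: sum.cartesian_product case_prod_unfold)
qed

lemma seq_dist_le_iff:
  assumes "m \<ge> 2" "x \<in> seq_space m" "y \<in> seq_space m"
  shows "seq_dist m x y \<le> 1 / real m ^ n \<longleftrightarrow> seq_prefix x n = seq_prefix y n"
proof (cases "x = y")
  case True
  then show ?thesis by (simp add: seq_dist_def)
next
  case False
  define N where "N = (LEAST n. x (n + 1) \<noteq> y (n + 1))"
  have "\<exists>i. x (i + 1) \<noteq> y (i + 1)"
  proof (rule ccontr)
    assume "\<not> ?thesis"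
    then have *: "x (i + 1) = y (i + 1)" for i
      by simp
    have "x i = y i" if "i \<ge> 1" for i
      using *[of "i - 1"] that by simp
    moreover have "x \<in> extensional {1..}" "y \<in> extensional {1..}"
      using assms by (auto simp: seq_space_def PiE_def)
    ultimately have "x = y" by (intro extensionalityI) auto
    with False show False by simp
  qed
  then have N: "x (N + 1) \<noteq> y (N + 1)" and least: "\<And>i. i < N \<Longrightarrow> x (i + 1) = y (i + 1)"
    unfolding N_def by (rule LeastI_ex) (use not_less_Least in blast)
  have dist: "seq_dist m x y = 1 / real m ^ N"
    using False by (simp add: seq_dist_def N_def)
  have "seq_dist m x y \<le> 1 / real m ^ n \<longleftrightarrow> real m ^ n \<le> real m ^ N"
    unfolding dist using assms(1) by (simp only: flip: inverse_eq_divide) (subst inverse_le_iff_le, auto)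
  also have "\<dots> \<longleftrightarrow> n \<le> N"
    using assms(1) by (intro power_increasing_iff) auto
  also have "\<dots> \<longleftrightarrow> (\<forall>i\<in>{1..n}. x i = y i)"
  proof
    assume "n \<le> N"
    show "\<forall>i\<in>{1..n}. x i = y i"
    proof
      fix i assume "i \<in> {1..n}"
      then have "i - 1 < N" "i - 1 + 1 = i" using \<open>n \<le> N\<close> by auto
      then show "x i = y i" using least[of "i - 1"] by simp
    qed
  next
    assume *: "\<forall>i\<in>{1..n}. x i = y i"
    show "n \<le> N"
    proof (rule ccontr)
      assume "\<not> n \<le> N"
      then have "N + 1 \<in> {1..n}" by simp
      with * N show False by blast
    qed
  qed
  finally show ?thesis by (simp add: seq_prefix_eq_iff)
qed

definition cylinder :: "nat \<Rightarrow> nat list \<Rightarrow> (nat \<Rightarrow> nat) set" where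
  "cylinder m w = {x \<in> seq_space m. seq_prefix x (length w) = w}"

lemma ediam_cylinder_le:
  assumes "m \<ge> 2"
  shows "ediam (seq_dist m) (cylinder m w) \<le> ennreal (1 / real m ^ length w)"
  unfolding ediam_def
  by (intro SUP_least ennreal_leI) (use assms in \<open>auto simp: cylinder_def seq_dist_le_iff\<close>)

lemma diam_weight_cylinder_le:
  assumes "m \<ge> 2" "t > 0"
  shows "diam_weight (seq_dist m) t (cylinder m w) \<le> ennreal (exp (- (real (length w) * (t * ln (real m)))))"
proof -
  have "enn2real (ediam (seq_dist m) (cylinder m w)) \<le> 1 / real m ^ length w"
    using ediam_cylinder_le[OF assms(1), of w] by (metis enn2real_leI divide_nonneg_nonneg of_nat_0_le_iff zero_le_one zero_le_power)
  then have "enn2real (ediam (seq_dist m) (cylinder m w)) powr t \<le> (1 / real m ^ length w) powr t"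
    using assms by (intro powr_mono2) auto
  also have "\<dots> = exp (- (real (length w) * (t * ln (real m))))"
    using assms by (simp add: powr_def ln_div ln_realpow)
  finally show ?thesis
    using assms by (auto simp: diam_weight_def intro: ennreal_leI)
qed

section \<open>Upper bounds for the Hausdorff dimension by weights of cylinders\<close>

lemma hausdorff_premeasure_le_cylinders:
  assumes "m \<ge> 2" "t > 0" and W: "W \<subseteq> lists {..<m}"
    and short: "\<And>w. w \<in> W \<Longrightarrow> 1 / real m ^ length w \<le> \<delta>"
    and cover: "\<And>x. x \<in> A \<Longrightarrow> x \<in> seq_space m \<and> (\<exists>n. seq_prefix x n \<in> W)"
    and bound: "\<And>F. finite F \<Longrightarrow> F \<subseteq> W \<Longrightarrow> (\<Sum>w\<in>F. exp (- (real (length w) * (t * ln (real m))))) \<le> B"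
  shows "hausdorff_premeasure (seq_space m) (seq_dist m) t \<delta> A \<le> ennreal B"
proof -
  define U where "U i = (if i \<in> to_nat ` W then cylinder m (from_nat i) else {})" for i :: nat
  have diam: "ediam (seq_dist m) (U i) \<le> ennreal \<delta>" for i
    using order_trans[OF ediam_cylinder_le[OF assms(1)] ennreal_leI[OF short]]
    by (auto simp: U_def ediam_def[of _ "{}"])
  have sub: "U i \<subseteq> seq_space m" for i
    by (auto simp: U_def cylinder_def)
  have cov: "A \<subseteq> (\<Union>i. U i)"
  proof
    fix x assume "x \<in> A"
    then obtain n where "x \<in> seq_space m" "seq_prefix x n \<in> W" using cover by blast
    then have "x \<in> U (to_nat (seq_prefix x n))"
      by (auto simp: U_def cylinder_def)
    then show "x \<in> (\<Union>i. U i)" by blast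
  qed
  have "(\<Sum>i<k. diam_weight (seq_dist m) t (U i)) \<le> ennreal B" for k
  proof -
    define F where "F = {w \<in> W. to_nat w < k}"
    have inj: "inj_on to_nat F" by (meson inj_on_subset inj_to_nat subset_UNIV)
    have img: "to_nat ` F = {i \<in> {..<k}. i \<in> to_nat ` W}" by (auto simp: F_def)
    have fin: "finite F"
      using img inj by (metis finite_Collect_conjI finite_imageD finite_lessThan Collect_mem_eq)
    have "(\<Sum>i<k. diam_weight (seq_dist m) t (U i)) = (\<Sum>i\<in>to_nat ` F. diam_weight (seq_dist m) t (U i))"
      unfolding img by (intro sum.mono_neutral_right) (auto simp: U_def diam_weight_def)
    also have "\<dots> = (\<Sum>w\<in>F. diam_weight (seq_dist m) t (U (to_nat w)))"
      using inj by (simp add: sum.reindex)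
    also have "\<dots> \<le> (\<Sum>w\<in>F. ennreal (exp (- (real (length w) * (t * ln (real m))))))"
      using diam_weight_cylinder_le[OF assms(1,2)] by (intro sum_mono) (auto simp: U_def F_def)
    also have "\<dots> = ennreal (\<Sum>w\<in>F. exp (- (real (length w) * (t * ln (real m)))))"
      by (simp add: sum_ennreal)
    also have "\<dots> \<le> ennreal B"
      by (intro ennreal_leI bound) (use fin in \<open>auto simp: F_def\<close>)
    finally show ?thesis .
  qed
  then have "(\<Sum>i. diam_weight (seq_dist m) t (U i)) \<le> ennreal B"
    by (simp add: suminf_eq_SUP SUP_least)
  moreover have "hausdorff_premeasure (seq_space m) (seq_dist m) t \<delta> A \<le> (\<Sum>i. diam_weight (seq_dist m) t (U i))"
    unfolding hausdorff_premeasure_def using diam sub cov by (intro INF_lower) auto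
  ultimately show ?thesis by simp
qed

text \<open>Since the weights of the words of length \<open>n\<close> add up to at most 1, at most \<open>exp (n (D + e))\<close> of these
words have weight \<open>exp (- n (D + e))\<close> or more. The cylinders of all such words with \<open>n \<ge> N\<close> cover \<open>A\<close>,
and in dimension \<open>(D + 2 e) / ln m\<close> they cost a geometric tail starting at \<open>N\<close>.\<close>

lemma hausdorff_dim_le_local_dim:
  assumes m: "m \<ge> 2" and A: "A \<subseteq> seq_space m" and D: "D \<ge> 0"
    and nonneg: "\<And>w. w \<in> lists {..<m} \<Longrightarrow> 0 \<le> \<mu> w"
    and total: "\<And>n. (\<Sum>w\<in>words m n. \<mu> w) \<le> 1"
    and heavy: "\<And>x e N. x \<in> A \<Longrightarrow> e > 0 \<Longrightarrow> \<exists>n\<ge>N. exp (- (real n * (D + e))) \<le> \<mu> (seq_prefix x n)"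
  shows "hausdorff_dim (seq_space m) (seq_dist m) A \<le> ereal (D / ln (real m))"
proof -
  have lnm: "ln (real m) > 0" using m by simp
  have null: "hausdorff_measure (seq_space m) (seq_dist m) ((D + 2 * e) / ln (real m)) A = 0" if e: "e > 0" for e
  proof -
    define t where "t = (D + 2 * e) / ln (real m)"
    have t: "t > 0" "t * ln (real m) = D + 2 * e" using D e lnm by (auto simp: t_def)
    have pre: "hausdorff_premeasure (seq_space m) (seq_dist m) t \<delta> A \<le> 0" if \<delta>: "\<delta> > 0" for \<delta>
    proof -
      have le: "hausdorff_premeasure (seq_space m) (seq_dist m) t \<delta> A \<le> ennreal (exp (-e) ^ N / (1 - exp (-e)))"
        if N: "1 / real m ^ N \<le> \<delta>" for N
      proof (rule hausdorff_premeasure_le_cylinders[OF m t(1)])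
        let ?W = "{w \<in> lists {..<m}. N \<le> length w \<and> exp (- (real (length w) * (D + e))) \<le> \<mu> w}"
        show "?W \<subseteq> lists {..<m}" by auto
        show "1 / real m ^ length w \<le> \<delta>" if "w \<in> ?W" for w
        proof -
          have "1 / real m ^ length w \<le> 1 / real m ^ N"
            using that m by (intro divide_left_mono power_increasing) auto
          with N show ?thesis by simp
        qed
        show "x \<in> seq_space m \<and> (\<exists>n. seq_prefix x n \<in> ?W)" if x: "x \<in> A" for x
        proof -
          obtain n where "n \<ge> N" "exp (- (real n * (D + e))) \<le> \<mu> (seq_prefix x n)"
            using heavy[OF x e] by blast
          then show ?thesis
            using x A seq_prefix_in_words[of x m n] by (intro conjI exI[of _ n]) (auto simp: words_def in_lists_conv_set)
        qed
        show "(\<Sum>w\<in>F. exp (- (real (length w) * (t * ln (real m))))) \<le> exp (-e) ^ N / (1 - exp (-e))"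
          if F: "finite F" "F \<subseteq> ?W" for F
        proof -
          have "(\<Sum>w\<in>F. exp (- (real (length w) * (t * ln (real m)))))
              = (\<Sum>n\<in>length ` F. \<Sum>w\<in>{w\<in>F. length w = n}. exp (- (real (length w) * (t * ln (real m)))))"
            using F by (intro sum.image_gen)
          also have "\<dots> \<le> (\<Sum>n\<in>length ` F. exp (-e) ^ n)"
          proof (intro sum_mono)
            fix n assume "n \<in> length ` F"
            have "(\<Sum>w\<in>{w\<in>F. length w = n}. exp (- (real (length w) * (t * ln (real m)))))
                \<le> (\<Sum>w\<in>{w\<in>F. length w = n}. exp (-e) ^ n * \<mu> w)"
            proof (intro sum_mono)
              fix w assume w: "w \<in> {w\<in>F. length w = n}"
              have "exp (- (real (length w) * (t * ln (real m)))) = exp (-e) ^ n * exp (- (real n * (D + e)))"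
                using w by (simp add: t exp_of_nat_mult[symmetric] mult_exp_exp algebra_simps)
              also have "\<dots> \<le> exp (-e) ^ n * \<mu> w"
                using w F by (intro mult_left_mono) auto
              finally show "exp (- (real (length w) * (t * ln (real m)))) \<le> exp (-e) ^ n * \<mu> w" .
            qed
            also have "\<dots> \<le> exp (-e) ^ n * (\<Sum>w\<in>words m n. \<mu> w)"
              unfolding sum_distrib_left[symmetric] using F nonneg
              by (intro mult_left_mono sum_mono2) (auto simp: words_def in_lists_conv_set intro: finite_words[unfolded words_def])
            also have "\<dots> \<le> exp (-e) ^ n * 1"
              by (intro mult_left_mono total) auto
            finally show "(\<Sum>w\<in>{w\<in>F. length w = n}. exp (- (real (length w) * (t * ln (real m))))) \<le> exp (-e) ^ n"
              by simp
          qed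
          also have "\<dots> \<le> (\<Sum>n\<in>{N..Max (insert N (length ` F))}. exp (-e) ^ n)"
            using F by (intro sum_mono2) (auto intro!: Max_ge)
          also have "\<dots> \<le> (\<Sum>n. exp (-e) ^ (n + N))"
          proof -
            let ?M = "Max (insert N (length ` F))"
            have "(\<Sum>n\<in>{N..?M}. exp (-e) ^ n) = (\<Sum>n<Suc ?M - N. exp (-e) ^ (n + N))"
              by (rule sum.reindex_bij_witness[of _ "\<lambda>n. n + N" "\<lambda>n. n - N"])
                 (use F in \<open>auto simp: less_diff_conv intro: Max_ge\<close>)
            also have "\<dots> \<le> (\<Sum>n. exp (-e) ^ (n + N))"
              using e by (intro sum_le_suminf) (auto simp: summable_iff_shift summable_geometric_iff)
            finally show ?thesis .
          qed
          also have "\<dots> = exp (-e) ^ N / (1 - exp (-e))"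
            using e by (simp add: power_add suminf_mult2[symmetric] suminf_geometric summable_geometric_iff)
          finally show ?thesis .
        qed
      qed
      have lim: "(\<lambda>N. ennreal (exp (-e) ^ N / (1 - exp (-e)))) \<longlonglongrightarrow> ennreal (0 / (1 - exp (-e)))"
        using e by (intro tendsto_ennrealI tendsto_divide LIMSEQ_power_zero tendsto_const) auto
      have "(\<lambda>N. 1 / real m ^ N) \<longlonglongrightarrow> 0"
        using m LIMSEQ_power_zero[of "1 / real m"] by (simp add: power_one_over)
      then have "eventually (\<lambda>N. 1 / real m ^ N \<le> \<delta>) sequentially"
        using \<delta> by (metis (mono_tags, lifting) eventually_mono less_imp_le order_tendstoD(2))
      then have "hausdorff_premeasure (seq_space m) (seq_dist m) t \<delta> A \<le> ennreal (0 / (1 - exp (-e)))"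
        using le by (intro tendsto_lowerbound[OF lim]) (auto elim: eventually_mono)
      then show ?thesis by simp
    qed
    have "hausdorff_measure (seq_space m) (seq_dist m) t A \<le> 0"
      unfolding hausdorff_measure_def by (rule SUP_least, rule pre) simp
    then show ?thesis unfolding t_def by simp
  qed
  have "hausdorff_dim (seq_space m) (seq_dist m) A \<le> ereal (D / ln (real m)) + ereal e" if e: "e > 0" for e
  proof -
    have "hausdorff_dim (seq_space m) (seq_dist m) A \<le> ereal ((D + 2 * (e * ln (real m) / 2)) / ln (real m))"
      unfolding hausdorff_dim_def using null[of "e * ln (real m) / 2"] e lnm D
      by (intro INF_lower) auto
    also have "(D + 2 * (e * ln (real m) / 2)) / ln (real m) = D / ln (real m) + e"
      using lnm by (simp add: field_simps)
    finally show ?thesis by simp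
  qed
  then show ?thesis by (rule ereal_le_epsilon2)
qed

section \<open>Null sets of a consistent weight and the mass distribution principle\<close>

text \<open>The values that a probability measure on the sequence space takes on cylinders.\<close>

locale consistent_weight =
  fixes m :: nat and \<mu> :: "nat list \<Rightarrow> real"
  assumes m_ge_2: "m \<ge> 2"
    and weight_nonneg: "w \<in> lists {..<m} \<Longrightarrow> 0 \<le> \<mu> w"
    and weight_Nil: "\<mu> [] = 1"
    and weight_split: "w \<in> lists {..<m} \<Longrightarrow> (\<Sum>j<m. \<mu> (w @ [j])) = \<mu> w"
begin

text \<open>Adding up weights of words of different lengths, this measure on the countable set of words is
infinite; it serves to bound the cost of covers by cylinders.\<close>

definition word_mass :: "nat list measure" where
  "word_mass = point_measure (lists {..<m}) (\<lambda>w. ennreal (\<mu> w))"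

lemma sets_word_mass [simp]: "A \<in> sets word_mass \<longleftrightarrow> A \<subseteq> lists {..<m}"
  by (auto simp: word_mass_def sets_point_measure)

lemma emeasure_word_mass_finite:
  assumes "finite A" "A \<subseteq> lists {..<m}"
  shows "emeasure word_mass A = ennreal (\<Sum>w\<in>A. \<mu> w)"
proof -
  have "emeasure word_mass A = (\<Sum>w\<in>A. ennreal (\<mu> w))"
    using assms unfolding word_mass_def by (intro emeasure_point_measure_finite2)
  also have "\<dots> = ennreal (\<Sum>w\<in>A. \<mu> w)"
    using assms weight_nonneg by (intro sum_ennreal) blast
  finally show ?thesis .
qed

lemma sum_weight_words: "(\<Sum>w\<in>words m n. \<mu> w) = 1"
proof (induction n)
  case 0
  then show ?case by (simp add: words_0 weight_Nil)
next
  case (Suc n)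
  have "(\<Sum>w\<in>words m (Suc n). \<mu> w) = (\<Sum>w\<in>words m n. \<mu> w)"
    unfolding sum_words_Suc by (intro sum.cong refl weight_split) (auto simp: words_def in_lists_conv_set)
  with Suc show ?case by simp
qed

text \<open>This replaces the compactness of the sequence space. Follow a path along which the words of \<open>W\<close>
extending the current word \<open>v\<close> have total mass below the weight of \<open>v\<close>. One of the one-letter
extensions of \<open>v\<close> inherits this, because both sides are additive; and such a \<open>v\<close> is not in \<open>W\<close>.\<close>

lemma ex_sequence_avoiding:
  assumes W: "W \<subseteq> lists {..<m}" and small: "emeasure word_mass W < 1"
  shows "\<exists>x\<in>seq_space m. \<forall>n. seq_prefix x n \<notin> W"
proof -
  define cone where "cone v = {w \<in> lists {..<m}. \<exists>u. w = v @ u}" for v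
  define P where "P n v \<longleftrightarrow> v \<in> words m n \<and> emeasure word_mass (W \<inter> cone v) < ennreal (\<mu> v)" for n v
  have lists: "v \<in> lists {..<m}" if "P n v" for n v
    using that by (auto simp: P_def words_def in_lists_conv_set)
  have "P 0 []"
    using assms by (auto simp: P_def words_0 weight_Nil cone_def Int_absorb2 subset_iff)
  moreover have "\<exists>v'. P (Suc n) v' \<and> (\<exists>j. v' = v @ [j])" if P: "P n v" for n v
  proof (rule ccontr)
    assume no: "\<not> ?thesis"
    have ge: "ennreal (\<mu> (v @ [j])) \<le> emeasure word_mass (W \<inter> cone (v @ [j]))" if "j < m" for j
    proof -
      have "v @ [j] \<in> words m (Suc n)" using P that by (auto simp: P_def words_def)
      then show ?thesis using no by (auto simp: P_def not_less)
    qed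
    have "ennreal (\<mu> v) = (\<Sum>j<m. ennreal (\<mu> (v @ [j])))"
      using lists[OF P] weight_nonneg by (subst sum_ennreal) (auto simp: weight_split)
    also have "\<dots> \<le> (\<Sum>j<m. emeasure word_mass (W \<inter> cone (v @ [j])))"
      using ge by (intro sum_mono) auto
    also have "\<dots> = emeasure word_mass (\<Union>j<m. W \<inter> cone (v @ [j]))"
      using W by (intro sum_emeasure) (auto simp: disjoint_family_on_def cone_def)
    also have "\<dots> \<le> emeasure word_mass (W \<inter> cone v)"
      using W by (intro emeasure_mono) (auto simp: cone_def)
    finally show False using P by (auto simp: P_def)
  qed
  ultimately obtain f where f: "\<And>n. P n (f n)" "\<And>n. \<exists>j. f (Suc n) = f n @ [j]"
    using dependent_nat_choice[of P "\<lambda>n v v'. \<exists>j. v' = v @ [j]"] by metis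
  define x where "x k = (if k = 0 then undefined else f k ! (k - 1))" for k
  have len: "length (f n) = n" for n using f(1)[of n] by (auto simp: P_def words_def)
  have pre: "seq_prefix x n = f n" for n
  proof (induction n)
    case 0
    then show ?case using len[of 0] by simp
  next
    case (Suc n)
    obtain j where "f (Suc n) = f n @ [j]" using f(2) by blast
    with Suc show ?case
      by (simp add: seq_prefix_Suc x_def nth_append len)
  qed
  have "x \<in> seq_space m"
  proof -
    have "x k < m" if "k \<ge> 1" for k
    proof -
      have "f k ! (k - 1) \<in> set (f k)" using len that by (intro nth_mem) auto
      then have "f k ! (k - 1) \<in> {..<m}" using f(1)[of k] unfolding P_def words_def by blast
      then show ?thesis using that by (simp add: x_def)
    qed
    then show ?thesis by (auto simp: seq_space_def PiE_def extensional_def x_def)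
  qed
  moreover have "seq_prefix x n \<notin> W" for n
  proof
    assume "seq_prefix x n \<in> W"
    then have "{f n} \<subseteq> W \<inter> cone (f n)" using W pre by (auto simp: cone_def)
    then have "emeasure word_mass {f n} \<le> emeasure word_mass (W \<inter> cone (f n))"
      using W by (intro emeasure_mono) auto
    moreover have "emeasure word_mass {f n} = ennreal (\<mu> (f n))"
      using lists[OF f(1)] by (subst emeasure_word_mass_finite) auto
    ultimately show False using f(1)[of n] by (auto simp: P_def)
  qed
  ultimately show ?thesis by blast
qed

text \<open>The null sets of the outer measure that a consistent weight induces through covers by cylinders.\<close>

definition weight_null :: "(nat \<Rightarrow> nat) set \<Rightarrow> bool" where
  "weight_null A \<longleftrightarrow> (\<forall>e>0. \<exists>W\<subseteq>lists {..<m}. emeasure word_mass W \<le> ennreal e \<and>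
      (\<forall>x\<in>A. \<exists>n. seq_prefix x n \<in> W))"

lemma weight_null_subset: "weight_null A \<Longrightarrow> B \<subseteq> A \<Longrightarrow> weight_null B"
  unfolding weight_null_def by (meson subsetD)

lemma not_weight_null_seq_space: "\<not> weight_null (seq_space m)"
proof
  assume "weight_null (seq_space m)"
  then obtain W where W: "W \<subseteq> lists {..<m}" "emeasure word_mass W \<le> ennreal (1/2)"
      "\<And>x. x \<in> seq_space m \<Longrightarrow> \<exists>n. seq_prefix x n \<in> W"
    unfolding weight_null_def by (metis half_gt_zero zero_less_one)
  have "ennreal (1/2) < 1" using ennreal_lessI[of 1 "1/2"] by simp
  with W(2) have "emeasure word_mass W < 1" by (rule le_less_trans)
  with ex_sequence_avoiding[OF W(1)] W(3) show False by blast
qed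

lemma suminf_ennreal_halves:
  assumes "e \<ge> 0"
  shows "(\<Sum>i. ennreal (e * (1/2) ^ Suc i)) = ennreal e"
proof -
  have "(\<lambda>i. e * (1/2) ^ Suc i) sums (e * 1)"
    by (intro sums_mult power_half_series)
  then show ?thesis using assms
    by (subst suminf_ennreal_eq[where x = e]) auto
qed

lemma weight_null_UN:
  fixes A :: "nat \<Rightarrow> (nat \<Rightarrow> nat) set"
  assumes "\<And>i. weight_null (A i)"
  shows "weight_null (\<Union>i. A i)"
  unfolding weight_null_def
proof (intro allI impI)
  fix e :: real assume e: "e > 0"
  have "\<exists>W\<subseteq>lists {..<m}. emeasure word_mass W \<le> ennreal (e * (1/2) ^ Suc i) \<and>
      (\<forall>x\<in>A i. \<exists>n. seq_prefix x n \<in> W)" for i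
  proof -
    have "e * (1/2) ^ Suc i > 0" using e by simp
    then show ?thesis using assms[of i] unfolding weight_null_def by blast
  qed
  then obtain W where W: "\<And>i. W i \<subseteq> lists {..<m}"
      "\<And>i. emeasure word_mass (W i) \<le> ennreal (e * (1/2) ^ Suc i)"
      "\<And>i x. x \<in> A i \<Longrightarrow> \<exists>n. seq_prefix x n \<in> W i"
    by metis
  have "emeasure word_mass (\<Union>i. W i) \<le> (\<Sum>i. emeasure word_mass (W i))"
    using W(1) by (intro emeasure_subadditive_countably) auto
  also have "\<dots> \<le> (\<Sum>i. ennreal (e * (1/2) ^ Suc i))"
    using W(2) by (intro suminf_le) auto
  also have "\<dots> = ennreal e"
    using e by (intro suminf_ennreal_halves) auto
  finally have small: "emeasure word_mass (\<Union>i. W i) \<le> ennreal e" .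
  show "\<exists>W\<subseteq>lists {..<m}. emeasure word_mass W \<le> ennreal e \<and> (\<forall>x\<in>\<Union>i. A i. \<exists>n. seq_prefix x n \<in> W)"
  proof (intro exI[of _ "\<Union>i. W i"] conjI ballI)
    fix x assume "x \<in> (\<Union>i. A i)"
    then obtain i where "x \<in> A i" by blast
    then show "\<exists>n. seq_prefix x n \<in> (\<Union>i. W i)" using W(3) by blast
  qed (use W(1) small in auto)
qed

lemma weight_null_Un:
  assumes "weight_null A" "weight_null B"
  shows "weight_null (A \<union> B)"
proof -
  have "weight_null (\<Union>i::nat. if i = 0 then A else B)"
    using assms by (intro weight_null_UN) auto
  then show ?thesis by (rule weight_null_subset) (auto split: if_splits intro: exI[of _ 0] exI[of _ 1])
qed

lemma borel_cantelli:
  assumes B: "\<And>n. B n \<subseteq> words m n" and sum: "summable (\<lambda>n. \<Sum>w\<in>B n. \<mu> w)"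
  shows "weight_null {x. \<exists>\<^sub>F n in sequentially. seq_prefix x n \<in> B n}"
  unfolding weight_null_def
proof (intro allI impI)
  fix e :: real assume e: "e > 0"
  have lists: "B n \<subseteq> lists {..<m}" for n using B[of n] by (auto simp: words_def)
  have fin: "finite (B n)" for n using B finite_words by (rule finite_subset)
  obtain N where N: "norm (\<Sum>n. \<Sum>w\<in>B (n + N). \<mu> w) < e"
    using suminf_exist_split[OF e sum] by blast
  have "emeasure word_mass (\<Union>n. B (n + N)) \<le> (\<Sum>n. emeasure word_mass (B (n + N)))"
    using lists by (intro emeasure_subadditive_countably) auto
  also have "\<dots> = (\<Sum>n. ennreal (\<Sum>w\<in>B (n + N). \<mu> w))"
    using emeasure_word_mass_finite[OF fin lists] by simp
  also have "\<dots> = ennreal (\<Sum>n. \<Sum>w\<in>B (n + N). \<mu> w)"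
    using weight_nonneg lists
    by (intro suminf_ennreal2 sum_nonneg summable_ignore_initial_segment sum) blast
  also have "\<dots> \<le> ennreal e" using N by (intro ennreal_leI) auto
  finally have small: "emeasure word_mass (\<Union>n. B (n + N)) \<le> ennreal e" .
  show "\<exists>W\<subseteq>lists {..<m}. emeasure word_mass W \<le> ennreal e \<and>
      (\<forall>x\<in>{x. \<exists>\<^sub>F n in sequentially. seq_prefix x n \<in> B n}. \<exists>n. seq_prefix x n \<in> W)"
  proof (intro exI[of _ "\<Union>n. B (n + N)"] conjI ballI)
    fix x assume "x \<in> {x. \<exists>\<^sub>F n in sequentially. seq_prefix x n \<in> B n}"
    then obtain n where "n \<ge> N" "seq_prefix x n \<in> B n" by (auto simp: frequently_sequentially)
    then show "\<exists>n. seq_prefix x n \<in> (\<Union>n. B (n + N))"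
      by (intro exI[of _ n] UN_I[of "n - N"]) auto
  qed (use lists small in auto)
qed

text \<open>A set \<open>U\<close> is replaced by the smallest cylinder around it. If \<open>U\<close> is a singleton there is none, and
its diameter has weight 0 for \<open>t > 0\<close>; the error \<open>\<eta>\<close> leaves room for a sufficiently long cylinder.\<close>

lemma weight_of_diameter:
  assumes U: "U \<subseteq> seq_space m" and x: "x \<in> U" and t: "t \<ge> 0" and \<eta>: "\<eta> > 0"
    and diam: "ediam (seq_dist m) U \<le> ennreal (1 / real m ^ N)"
  shows "\<exists>n\<ge>N. (\<forall>y\<in>U. seq_prefix y n = seq_prefix x n) \<and>
     ennreal (exp (- (real n * (t * ln (real m))))) \<le> diam_weight (seq_dist m) t U + ennreal \<eta>"
proof -
  have dist_le: "ennreal (seq_dist m y z) \<le> ediam (seq_dist m) U" if "y \<in> U" "z \<in> U" for y z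
    unfolding ediam_def using that by (intro SUP_upper2[of y] SUP_upper2[of z]) auto
  have N: "seq_prefix y N = seq_prefix x N" if "y \<in> U" for y
  proof -
    have "ennreal (seq_dist m y x) \<le> ennreal (1 / real m ^ N)"
      using dist_le[OF that x] diam by (rule order_trans)
    then show ?thesis
      using seq_dist_le_iff[OF m_ge_2] U that x by (subst (asm) ennreal_le_iff) auto
  qed
  show ?thesis
  proof (cases "t = 0")
    case True
    have "(1::ennreal) \<le> 1 + ennreal \<eta>" by simp
    moreover have "U \<noteq> {}" using x by blast
    ultimately show ?thesis using True N by (intro exI[of _ N]) (simp add: diam_weight_def)
  next
    case False
    then have t: "t > 0" using t by simp
    \<comment> \<open>The lengths of the cylinders that contain \<open>U\<close>.\<close>
    define S where "S = {n. \<forall>y\<in>U. seq_prefix y n = seq_prefix x n}"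
    have "N \<in> S" using N by (auto simp: S_def)
    show ?thesis
    proof (cases "finite S")
      case True
      define n where "n = Max S"
      have n: "n \<in> S" "N \<le> n" "Suc n \<notin> S"
        unfolding n_def using True \<open>N \<in> S\<close>
        by (blast intro: Max_in Max_ge, blast intro: Max_ge, metis Max_ge Suc_n_not_le_n)
      then obtain y where y: "y \<in> U" "seq_prefix y (Suc n) \<noteq> seq_prefix x (Suc n)"
        by (auto simp: S_def)
      have far: "\<not> seq_dist m y x \<le> 1 / real m ^ Suc n"
        using seq_dist_le_iff[OF m_ge_2, of y x "Suc n"] y x U by auto
      have "y \<noteq> x" using y by auto
      then obtain M where M: "seq_dist m y x = 1 / real m ^ M" by (auto simp: seq_dist_def)
      have "\<not> M \<ge> Suc n"
      proof
        assume "M \<ge> Suc n"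
        then have "real m ^ Suc n \<le> real m ^ M" using m_ge_2 by (intro power_increasing) auto
        then have "1 / real m ^ M \<le> 1 / real m ^ Suc n" using m_ge_2 by (intro divide_left_mono) auto
        with far M show False by simp
      qed
      then have "real m ^ M \<le> real m ^ n" using m_ge_2 by (intro power_increasing) auto
      then have "1 / real m ^ n \<le> seq_dist m y x"
        unfolding M using m_ge_2 by (intro divide_left_mono) auto
      moreover have "seq_dist m y x \<le> enn2real (ediam (seq_dist m) U)"
      proof -
        have "ediam (seq_dist m) U < top" using diam by (simp add: le_less_trans)
        then have "ediam (seq_dist m) U = ennreal (enn2real (ediam (seq_dist m) U))" by simp
        then show ?thesis using dist_le[OF y(1) x] by (metis enn2real_nonneg ennreal_le_iff)
      qed
      ultimately have "(1 / real m ^ n) powr t \<le> enn2real (ediam (seq_dist m) U) powr t"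
        using m_ge_2 t by (intro powr_mono2) auto
      moreover have "(1 / real m ^ n) powr t = exp (- (real n * (t * ln (real m))))"
        using m_ge_2 by (simp add: powr_def ln_div ln_realpow)
      ultimately have "ennreal (exp (- (real n * (t * ln (real m))))) \<le> diam_weight (seq_dist m) t U"
        using t x by (auto simp: diam_weight_def intro: ennreal_leI)
      also have "\<dots> \<le> diam_weight (seq_dist m) t U + ennreal \<eta>" by simp
      finally show ?thesis using n by (intro exI[of _ n]) (auto simp: S_def)
    next
      case False
      have pos: "exp (- (t * ln (real m))) < 1" using t m_ge_2 by simp
      have "(\<lambda>n. exp (- (t * ln (real m))) ^ n) \<longlonglongrightarrow> 0"
        using pos by (intro LIMSEQ_power_zero) auto
      then have "eventually (\<lambda>n. exp (- (t * ln (real m))) ^ n < \<eta>) sequentially"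
        using \<eta> by (rule order_tendstoD)
      then obtain K where K: "\<And>n. n \<ge> K \<Longrightarrow> exp (- (t * ln (real m))) ^ n < \<eta>"
        by (auto simp: eventually_sequentially)
      obtain n where n: "n \<in> S" "n \<ge> max N K" using False by (metis infinite_nat_iff_unbounded_le)
      have "exp (- (real n * (t * ln (real m)))) < \<eta>"
        using K[of n] n by (simp add: exp_of_nat_mult[symmetric])
      then have "ennreal (exp (- (real n * (t * ln (real m))))) \<le> ennreal \<eta>" by (intro ennreal_leI) auto
      also have "\<dots> \<le> diam_weight (seq_dist m) t U + ennreal \<eta>" by simp
      finally show ?thesis using n by (intro exI[of _ n]) (auto simp: S_def)
    qed
  qed
qed

text \<open>The mass distribution principle: a cheap cover of \<open>A\<close> by small sets yields a cover of \<open>A'\<close> by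
cylinders, whose weights are bounded, up to a small error, by the \<open>t\<close>-th powers of the diameters.\<close>

lemma hausdorff_null_imp_weight_null_uniform:
  assumes A: "A \<subseteq> seq_space m" "A' \<subseteq> A" and t: "t \<ge> 0"
    and null: "hausdorff_measure (seq_space m) (seq_dist m) t A = 0"
    and light: "\<And>x n. x \<in> A' \<Longrightarrow> n \<ge> N \<Longrightarrow> \<mu> (seq_prefix x n) \<le> exp (- (real n * (t * ln (real m))))"
  shows "weight_null A'"
  unfolding weight_null_def
proof (intro allI impI)
  fix e :: real assume e: "e > 0"
  let ?d = "seq_dist m" and ?\<delta> = "1 / real m ^ N"
  have "hausdorff_premeasure (seq_space m) ?d t ?\<delta> A \<le> hausdorff_measure (seq_space m) ?d t A"
    unfolding hausdorff_measure_def using m_ge_2 by (intro SUP_upper) auto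
  also have "\<dots> < ennreal (e / 2)" using null e by simp
  finally obtain U where U: "\<And>i. U i \<subseteq> seq_space m" "\<And>i. ediam ?d (U i) \<le> ennreal ?\<delta>" "A \<subseteq> (\<Union>i. U i)"
      and sum: "(\<Sum>i. diam_weight ?d t (U i)) < ennreal (e / 2)"
    unfolding hausdorff_premeasure_def INF_less_iff by auto
  define I where "I = {i. U i \<inter> A' \<noteq> {}}"
  have "\<exists>w\<in>lists {..<m}. (\<forall>y\<in>U i. \<exists>n. seq_prefix y n = w) \<and>
      ennreal (\<mu> w) \<le> diam_weight ?d t (U i) + ennreal (e / 2 * (1/2) ^ Suc i)" if i: "i \<in> I" for i
  proof -
    obtain x where x: "x \<in> U i" "x \<in> A'" using i by (auto simp: I_def)
    obtain n where n: "n \<ge> N" "\<And>y. y \<in> U i \<Longrightarrow> seq_prefix y n = seq_prefix x n"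
        "ennreal (exp (- (real n * (t * ln (real m))))) \<le> diam_weight ?d t (U i) + ennreal (e / 2 * (1/2) ^ Suc i)"
      using weight_of_diameter[OF U(1) x(1) t _ U(2), of "e / 2 * (1/2) ^ Suc i"] e by auto
    have "ennreal (\<mu> (seq_prefix x n)) \<le> ennreal (exp (- (real n * (t * ln (real m)))))"
      using light[OF x(2) n(1)] by (intro ennreal_leI)
    also note n(3)
    finally have "ennreal (\<mu> (seq_prefix x n)) \<le> diam_weight ?d t (U i) + ennreal (e / 2 * (1/2) ^ Suc i)" .
    moreover have "seq_prefix x n \<in> lists {..<m}"
      using seq_prefix_in_words[of x m n] x U(1)[of i] by (auto simp: words_def)
    ultimately show ?thesis using n(2) by blast
  qed
  then obtain w where w: "\<And>i. i \<in> I \<Longrightarrow> w i \<in> lists {..<m}"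
      "\<And>i y. i \<in> I \<Longrightarrow> y \<in> U i \<Longrightarrow> \<exists>n. seq_prefix y n = w i"
      "\<And>i. i \<in> I \<Longrightarrow> ennreal (\<mu> (w i)) \<le> diam_weight ?d t (U i) + ennreal (e / 2 * (1/2) ^ Suc i)"
    by metis
  define V where "V i = (if i \<in> I then {w i} else {})" for i
  have V: "V i \<subseteq> lists {..<m}" for i using w(1) by (auto simp: V_def)
  have "emeasure word_mass (\<Union>i. V i) \<le> (\<Sum>i. emeasure word_mass (V i))"
    using V by (intro emeasure_subadditive_countably) auto
  also have "\<dots> \<le> (\<Sum>i. diam_weight ?d t (U i) + ennreal (e / 2 * (1/2) ^ Suc i))"
  proof (intro suminf_le)
    fix i
    show "emeasure word_mass (V i) \<le> diam_weight ?d t (U i) + ennreal (e / 2 * (1/2) ^ Suc i)"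
    proof (cases "i \<in> I")
      case True
      then have "emeasure word_mass (V i) = ennreal (\<mu> (w i))"
        using w(1) by (subst emeasure_word_mass_finite) (auto simp: V_def)
      then show ?thesis using w(3)[OF True] by simp
    qed (simp add: V_def)
  qed auto
  also have "\<dots> = (\<Sum>i. diam_weight ?d t (U i)) + (\<Sum>i. ennreal (e / 2 * (1/2) ^ Suc i))"
    by (intro suminf_add[symmetric]) auto
  also have "\<dots> \<le> ennreal (e / 2) + ennreal (e / 2)"
    using sum e by (subst suminf_ennreal_halves) (auto intro: add_mono)
  also have "\<dots> = ennreal e" using e by (simp flip: ennreal_plus)
  finally have small: "emeasure word_mass (\<Union>i. V i) \<le> ennreal e" .
  show "\<exists>W\<subseteq>lists {..<m}. emeasure word_mass W \<le> ennreal e \<and> (\<forall>x\<in>A'. \<exists>n. seq_prefix x n \<in> W)"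
  proof (intro exI[of _ "\<Union>i. V i"] conjI ballI)
    fix x assume x: "x \<in> A'"
    then obtain i where i: "x \<in> U i" using U(3) A by blast
    then have "i \<in> I" using x by (auto simp: I_def)
    then show "\<exists>n. seq_prefix x n \<in> (\<Union>i. V i)" using w(2)[OF _ i] by (fastforce simp: V_def)
  qed (use V small in auto)
qed

text \<open>The threshold after which prefixes are light depends on the point, so \<open>A\<close> is split into countably
many sets with a uniform threshold.\<close>

lemma local_dim_le_hausdorff_dim:
  assumes A: "A \<subseteq> seq_space m" and big: "\<not> weight_null A"
    and light: "\<And>x e. x \<in> A \<Longrightarrow> e > 0 \<Longrightarrow>
       eventually (\<lambda>n. \<mu> (seq_prefix x n) \<le> exp (- (real n * (D - e)))) sequentially"
  shows "ereal (D / ln (real m)) \<le> hausdorff_dim (seq_space m) (seq_dist m) A"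
  unfolding hausdorff_dim_def
proof (intro INF_greatest, rule ccontr)
  fix t assume t: "t \<in> {t. 0 \<le> t \<and> hausdorff_measure (seq_space m) (seq_dist m) t A = 0}"
    and "\<not> ereal (D / ln (real m)) \<le> ereal t"
  then have less: "t * ln (real m) < D" using m_ge_2 by (simp add: field_simps)
  define A' where "A' N = {x \<in> A. \<forall>n\<ge>N. \<mu> (seq_prefix x n) \<le> exp (- (real n * (t * ln (real m))))}" for N
  have "weight_null (A' N)" for N
    using A t by (intro hausdorff_null_imp_weight_null_uniform[of A _ t N]) (auto simp: A'_def)
  then have "weight_null (\<Union>N. A' N)" by (rule weight_null_UN)
  moreover have "A \<subseteq> (\<Union>N. A' N)"
  proof
    fix x assume x: "x \<in> A"
    have "eventually (\<lambda>n. \<mu> (seq_prefix x n) \<le> exp (- (real n * (t * ln (real m))))) sequentially"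
      using light[OF x, of "D - t * ln (real m)"] less by simp
    then show "x \<in> (\<Union>N. A' N)"
      using x unfolding A'_def eventually_sequentially by blast
  qed
  ultimately show False using big weight_null_subset by blast
qed

end

section \<open>Windows along multiplicative chains\<close>

locale telescoping =
  fixes m l q :: nat
  assumes m_ge_2: "m \<ge> 2" and l_ge_2: "l \<ge> 2" and q_ge_2: "q \<ge> 2"
begin

text \<open>The window at \<open>k\<close>, cut down to what the entry at \<open>k q\<close> remembers of it, namely at most \<open>l - 1\<close> letters.\<close>

definition trunc :: "nat list \<Rightarrow> nat list" where
  "trunc w = (if length w = l then tl w else w)"

text \<open>The window at \<open>k\<close> lists the last \<open>l\<close> entries of \<open>x\<close> on the chain \<open>\<dots>, k/q\<^sup>2, k/q, k\<close>, or all of them if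
the chain is shorter. The guard \<open>0 < k\<close> makes the recursion terminate at the unused index 0.\<close>

function window :: "(nat \<Rightarrow> nat) \<Rightarrow> nat \<Rightarrow> nat list" where
  "window x k = (if q dvd k \<and> 0 < k then trunc (window x (k div q)) else []) @ [x k]"
  by auto
termination
  by (relation "Wellfounded.measure snd") (use q_ge_2 in auto)

declare window.simps [simp del]

definition past :: "(nat \<Rightarrow> nat) \<Rightarrow> nat \<Rightarrow> nat list" where
  "past x k = (if q dvd k \<and> 0 < k then trunc (window x (k div q)) else [])"

definition blocks :: "nat list set" where
  "blocks = {w \<in> lists {..<m}. length w \<le> l}"

definition pasts :: "nat list set" where
  "pasts = {w \<in> lists {..<m}. length w < l}"

lemma window_eq: "window x k = past x k @ [x k]"
  unfolding past_def by (rule window.simps)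

lemma finite_blocks [simp]: "finite blocks"
proof -
  have "blocks = {w. set w \<subseteq> {..<m} \<and> length w \<le> l}"
    by (auto simp: blocks_def)
  then show ?thesis by (simp add: finite_lists_length_le)
qed

lemma Nil_in_pasts [simp]: "[] \<in> pasts"
  using l_ge_2 by (simp add: pasts_def)

lemma pasts_subset_blocks: "a \<in> pasts \<Longrightarrow> a \<in> blocks"
  by (simp add: pasts_def blocks_def)

lemma snoc_in_blocks: "a \<in> pasts \<Longrightarrow> j < m \<Longrightarrow> a @ [j] \<in> blocks"
  by (auto simp: pasts_def blocks_def)

lemma trunc_in_pasts: "w \<in> blocks \<Longrightarrow> trunc w \<in> pasts"
  using l_ge_2 by (auto simp: trunc_def pasts_def blocks_def dest: list.set_sel(2)[rotated])

lemma window_in_blocks: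
  assumes "x \<in> seq_space m" "k \<ge> 1"
  shows "window x k \<in> blocks"
  using assms(2)
proof (induction k rule: less_induct)
  case (less k)
  have "x k < m" using assms(1) less.prems by (auto simp: seq_space_def PiE_def Pi_def)
  moreover have "past x k \<in> pasts"
  proof (cases "q dvd k")
    case True
    then have "k div q < k" "k div q \<ge> 1" using less.prems q_ge_2 by (auto elim!: dvdE)
    with less.IH show ?thesis by (simp add: past_def trunc_in_pasts)
  qed (simp add: past_def)
  ultimately show ?case by (simp add: window_eq snoc_in_blocks)
qed

lemma past_in_pasts:
  assumes "x \<in> seq_space m"
  shows "past x k \<in> pasts"
proof (cases "q dvd k \<and> 0 < k")
  case True
  then have "k div q \<ge> 1" using q_ge_2 by (auto elim!: dvdE)
  then show ?thesis using assms by (simp add: past_def trunc_in_pasts window_in_blocks)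
qed (auto simp: past_def)

lemma window_cong:
  assumes "\<And>i. 1 \<le> i \<Longrightarrow> i \<le> k \<Longrightarrow> x i = y i" "k \<ge> 1"
  shows "window x k = window y k"
  using assms
proof (induction k rule: less_induct)
  case (less k)
  have "past x k = past y k"
  proof (cases "q dvd k")
    case True
    then have "k div q < k" "k div q \<ge> 1" using less.prems q_ge_2 by (auto elim!: dvdE)
    with less show ?thesis by (simp add: past_def)
  qed (simp add: past_def)
  with less.prems show ?case by (simp add: window_eq)
qed

lemma past_cong:
  assumes "\<And>i. 1 \<le> i \<Longrightarrow> i < k \<Longrightarrow> x i = y i"
  shows "past x k = past y k"
proof (cases "q dvd k \<and> 0 < k")
  case True
  then have "k div q < k" "k div q \<ge> 1" using q_ge_2 by (auto elim!: dvdE)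
  with assms window_cong[of "k div q" x y] show ?thesis by (simp add: past_def)
qed (auto simp: past_def)

text \<open>Some sequence with prefix \<open>w\<close>. Sums over words can then refer to windows, which depend on \<open>w\<close> only
as long as they end within \<open>w\<close>.\<close>

definition extend :: "nat list \<Rightarrow> nat \<Rightarrow> nat" where
  "extend w k = (if k = 0 then undefined else if k \<le> length w then w ! (k - 1) else 0)"

lemma extend_in_seq_space: "w \<in> lists {..<m} \<Longrightarrow> extend w \<in> seq_space m"
  using m_ge_2 by (auto simp: seq_space_def PiE_def extensional_def extend_def in_lists_conv_set)

lemma extend_prefix:
  assumes "1 \<le> k" "k \<le> n"
  shows "extend (seq_prefix x n) k = x k"
  using assms seq_prefix_nth[of "k - 1" n x] by (simp add: extend_def)

lemma extend_snoc:
  shows "1 \<le> k \<Longrightarrow> k \<le> length w \<Longrightarrow> extend (w @ [j]) k = extend w k"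
    and "extend (w @ [j]) (Suc (length w)) = j"
  by (auto simp: extend_def nth_append)

lemma window_extend_snoc:
  shows "1 \<le> k \<Longrightarrow> k \<le> length w \<Longrightarrow> window (extend (w @ [j])) k = window (extend w) k"
    and "window (extend (w @ [j])) (Suc (length w)) = past (extend w) (Suc (length w)) @ [j]"
    and "k \<le> Suc (length w) \<Longrightarrow> past (extend (w @ [j])) k = past (extend w) k"
proof -
  show past: "past (extend (w @ [j])) k = past (extend w) k" if "k \<le> Suc (length w)" for k
    using that by (intro past_cong) (auto simp: extend_snoc)
  show "window (extend (w @ [j])) k = window (extend w) k" if "1 \<le> k" "k \<le> length w"
    using that by (intro window_cong) (auto simp: extend_snoc)
  show "window (extend (w @ [j])) (Suc (length w)) = past (extend w) (Suc (length w)) @ [j]"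
    by (simp add: window_eq past extend_snoc)
qed

lemma bounded_on_blocks: "\<exists>C>0. \<forall>w\<in>blocks. \<bar>f w\<bar> \<le> (C::real)"
proof (intro exI conjI ballI)
  fix w assume "w \<in> blocks"
  then have "\<bar>f w\<bar> \<le> (\<Sum>w\<in>blocks. \<bar>f w\<bar>)" by (intro member_le_sum) auto
  then show "\<bar>f w\<bar> \<le> 1 + (\<Sum>w\<in>blocks. \<bar>f w\<bar>)" by simp
qed (simp add: sum_nonneg add_pos_nonneg)

text \<open>An index not divisible by \<open>q\<close> starts a chain and has an empty past; the past of \<open>k q\<close> is the truncated
window at \<open>k\<close>. This is the recursion from \<open>n\<close> to \<open>n/q\<close> behind all asymptotics below.\<close>

lemma sum_past:
  fixes f :: "nat list \<Rightarrow> real"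
  shows "(\<Sum>k=1..n. f (past x k)) = real (n - n div q) * f [] + (\<Sum>k=1..n div q. f (trunc (window x k)))"
proof -
  have q: "q > 0" using q_ge_2 by simp
  have mult: "{k\<in>{1..n}. q dvd k} = (\<lambda>k. q * k) ` {1..n div q}"
    using q by (force simp: less_eq_div_iff_mult_less_eq mult.commute elim!: dvdE)
  have inj: "inj_on (\<lambda>k. q * k) {1..n div q}" using q by (auto simp: inj_on_def)
  have card: "card {k\<in>{1..n}. q dvd k} = n div q"
    unfolding mult using card_image[OF inj] by simp
  have diff: "{k\<in>{1..n}. \<not> q dvd k} = {1..n} - {k\<in>{1..n}. q dvd k}" by auto
  have "card {k\<in>{1..n}. \<not> q dvd k} = card {1..n} - card {k\<in>{1..n}. q dvd k}"
    unfolding diff by (rule card_Diff_subset) auto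
  then have card': "card {k\<in>{1..n}. \<not> q dvd k} = n - n div q"
    unfolding card by simp
  have "(\<Sum>k=1..n. f (past x k)) = (\<Sum>k\<in>{k\<in>{1..n}. \<not> q dvd k}. f (past x k)) + (\<Sum>k\<in>{k\<in>{1..n}. q dvd k}. f (past x k))"
    by (subst sum.union_disjoint[symmetric]) (auto intro!: sum.cong)
  also have "(\<Sum>k\<in>{k\<in>{1..n}. \<not> q dvd k}. f (past x k)) = (\<Sum>k\<in>{k\<in>{1..n}. \<not> q dvd k}. f [])"
    by (intro sum.cong) (auto simp: past_def)
  also have "\<dots> = real (n - n div q) * f []"
    using card' by simp
  also have "(\<Sum>k\<in>{k\<in>{1..n}. q dvd k}. f (past x k)) = (\<Sum>k=1..n div q. f (past x (q * k)))"
    unfolding mult using sum.reindex[OF inj, of "\<lambda>k. f (past x k)"] by (simp add: o_def)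
  also have "\<dots> = (\<Sum>k=1..n div q. f (trunc (window x k)))"
    using q by (intro sum.cong) (auto simp: past_def)
  finally show ?thesis .
qed

lemma filterlim_div: "filterlim (\<lambda>n. n div q) at_top sequentially"
  unfolding filterlim_at_top
proof
  fix Z
  show "eventually (\<lambda>n. Z \<le> n div q) sequentially"
    using eventually_ge_at_top[of "Z * q"]
    by eventually_elim (use q_ge_2 in \<open>simp add: less_eq_div_iff_mult_less_eq\<close>)
qed

lemma tendsto_div_ratio: "(\<lambda>n. real (n div q) / real n) \<longlonglongrightarrow> 1 / real q"
proof (rule tendsto_sandwich)
  have lower: "real n / real q - 1 \<le> real (n div q)" for n
  proof -
    have "real (n mod q) / real q \<le> 1"
      using q_ge_2 by (simp add: divide_le_eq less_imp_le)
    then show ?thesis using of_nat_of_nat_div_aux[of n q, where ?'a = real] by simp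
  qed
  show "eventually (\<lambda>n. 1 / real q - 1 / real n \<le> real (n div q) / real n) sequentially"
    using eventually_gt_at_top[of 0]
  proof eventually_elim
    case (elim n)
    then have "1 / real q - 1 / real n = (real n / real q - 1) / real n" by (simp add: field_simps)
    also have "\<dots> \<le> real (n div q) / real n" by (intro divide_right_mono lower) simp
    finally show ?case .
  qed
  show "eventually (\<lambda>n. real (n div q) / real n \<le> 1 / real q) sequentially"
    using q_ge_2 of_nat_div_le_of_nat[of _ q, where ?'a = real] by (intro eventually_sequentiallyI[of 1]) (simp add: field_simps)
  show "(\<lambda>n. 1 / real q - 1 / real n) \<longlonglongrightarrow> 1 / real q"
    using tendsto_diff[OF tendsto_const lim_1_over_n, of "1 / real q"] by simp
qed simp

text \<open>The conditional expectation of \<open>g\<close> of the window, given the past \<open>a\<close>.\<close>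

definition mean :: "(nat list \<Rightarrow> real) \<Rightarrow> (nat list \<Rightarrow> real) \<Rightarrow> nat list \<Rightarrow> real" where
  "mean p g a = (\<Sum>j<m. p (a @ [j]) * g (a @ [j]))"

end

section \<open>Markov weights and their law of large numbers\<close>

locale transition_kernel = telescoping +
  fixes p :: "nat list \<Rightarrow> real"
  assumes p_nonneg: "w \<in> blocks \<Longrightarrow> 0 \<le> p w"
    and p_sum: "a \<in> pasts \<Longrightarrow> (\<Sum>j<m. p (a @ [j])) = 1"
begin

definition chain_weight :: "nat list \<Rightarrow> real" where
  "chain_weight w = (\<Prod>k=1..length w. p (window (extend w) k))"

lemma chain_weight_prefix: "chain_weight (seq_prefix x n) = (\<Prod>k=1..n. p (window x k))"
  unfolding chain_weight_def length_seq_prefix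
  by (intro prod.cong refl arg_cong[where f = p] window_cong) (auto simp: extend_prefix)

lemma chain_weight_snoc: "chain_weight (w @ [j]) = chain_weight w * p (past (extend w) (Suc (length w)) @ [j])"
proof -
  have "chain_weight (w @ [j]) = (\<Prod>k=1..length w. p (window (extend (w @ [j])) k)) * p (window (extend (w @ [j])) (Suc (length w)))"
    by (simp add: chain_weight_def)
  also have "(\<Prod>k=1..length w. p (window (extend (w @ [j])) k)) = chain_weight w"
    unfolding chain_weight_def by (intro prod.cong refl) (auto simp: window_extend_snoc)
  finally show ?thesis by (simp add: window_extend_snoc)
qed

sublocale consistent_weight m chain_weight
proof
  show "0 \<le> chain_weight w" if "w \<in> lists {..<m}" for w
    unfolding chain_weight_def
    by (intro prod_nonneg p_nonneg window_in_blocks extend_in_seq_space that) auto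
  show "(\<Sum>j<m. chain_weight (w @ [j])) = chain_weight w" if "w \<in> lists {..<m}" for w
    unfolding chain_weight_snoc sum_distrib_left[symmetric]
    by (simp add: p_sum past_in_pasts extend_in_seq_space that)
qed (simp_all add: m_ge_2 chain_weight_def)

definition deviation :: "(nat list \<Rightarrow> real) \<Rightarrow> (nat \<Rightarrow> nat) \<Rightarrow> nat \<Rightarrow> real" where
  "deviation g x k = g (window x k) - mean p g (past x k)"

lemma abs_mean_le:
  assumes a: "a \<in> pasts" and g: "\<And>j. j < m \<Longrightarrow> \<bar>g (a @ [j])\<bar> \<le> C"
  shows "\<bar>mean p g a\<bar> \<le> C"
proof -
  have "\<bar>mean p g a\<bar> \<le> (\<Sum>j<m. \<bar>p (a @ [j]) * g (a @ [j])\<bar>)"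
    unfolding mean_def by (rule sum_abs)
  also have "\<dots> \<le> (\<Sum>j<m. p (a @ [j]) * C)"
    using a g by (intro sum_mono) (auto simp: abs_mult p_nonneg snoc_in_blocks intro!: mult_left_mono)
  also have "\<dots> = C" by (simp add: sum_distrib_right[symmetric] p_sum a)
  finally show ?thesis .
qed

end

lemma exp_le_quadratic:
  fixes y :: real
  assumes "\<bar>y\<bar> \<le> 1"
  shows "exp y \<le> 1 + y + y\<^sup>2"
proof (cases "y \<ge> 0")
  case True
  then show ?thesis using assms exp_bound[of y] by simp
next
  case False
  define z where "z = - y"
  have z: "z > 0" using False by (simp add: z_def)
  have pos: "1 + z + z\<^sup>2 / 2 > 0" using z by (intro add_pos_nonneg) auto
  have "1 + z + z\<^sup>2 / 2 \<le> exp z" using z by (intro exp_lower_Taylor_quadratic) auto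
  then have "exp y \<le> 1 / (1 + z + z\<^sup>2 / 2)"
    using pos by (simp add: z_def exp_minus field_simps)
  also have "\<dots> \<le> 1 - z + z\<^sup>2"
  proof -
    have "(1 - z + z\<^sup>2) * (1 + z + z\<^sup>2 / 2) = 1 + z\<^sup>2 / 2 + z ^ 3 / 2 + z ^ 4 / 2"
      by (simp add: field_simps power2_eq_square power3_eq_cube power4_eq_xxxx)
    also have "\<dots> \<ge> 1" using z by simp
    finally show ?thesis using pos by (simp add: field_simps)
  qed
  finally show ?thesis by (simp add: z_def)
qed

context transition_kernel
begin

text \<open>By \<open>exp y \<le> 1 + y + y\<^sup>2\<close>, where the linear term has expectation 0.\<close>

lemma exp_moment_step:
  assumes a: "a \<in> pasts" and g: "\<And>w. w \<in> blocks \<Longrightarrow> \<bar>g w\<bar> \<le> C" and \<epsilon>: "\<epsilon> \<ge> 0" "\<epsilon> * (2 * C) \<le> 1"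
  shows "(\<Sum>j<m. p (a @ [j]) * exp (\<epsilon> * (g (a @ [j]) - mean p g a))) \<le> exp ((\<epsilon> * (2 * C))\<^sup>2)"
proof -
  define d where "d j = g (a @ [j]) - mean p g a" for j
  have "\<bar>mean p g a\<bar> \<le> C" using a g by (intro abs_mean_le) (auto simp: snoc_in_blocks)
  then have "\<bar>d j\<bar> \<le> 2 * C" if "j < m" for j
    using g[OF snoc_in_blocks[OF a that]] unfolding d_def by linarith
  then have d: "\<bar>\<epsilon> * d j\<bar> \<le> \<epsilon> * (2 * C)" if "j < m" for j
    using that \<epsilon> by (auto simp: abs_mult intro!: mult_left_mono)
  have "(\<Sum>j<m. p (a @ [j]) * exp (\<epsilon> * d j)) \<le> (\<Sum>j<m. p (a @ [j]) * (1 + \<epsilon> * d j + (\<epsilon> * (2 * C))\<^sup>2))"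
  proof (intro sum_mono mult_left_mono)
    fix j assume j: "j \<in> {..<m}"
    have "exp (\<epsilon> * d j) \<le> 1 + \<epsilon> * d j + (\<epsilon> * d j)\<^sup>2"
      using d[of j] j \<epsilon> by (intro exp_le_quadratic) auto
    moreover have "(\<epsilon> * d j)\<^sup>2 \<le> (\<epsilon> * (2 * C))\<^sup>2"
      using d[of j] j abs_le_square_iff[of "\<epsilon> * d j" "\<epsilon> * (2 * C)"] by auto
    ultimately show "exp (\<epsilon> * d j) \<le> 1 + \<epsilon> * d j + (\<epsilon> * (2 * C))\<^sup>2" by linarith
  qed (use a in \<open>auto simp: p_nonneg snoc_in_blocks\<close>)
  also have "(\<Sum>j<m. p (a @ [j]) * (1 + \<epsilon> * d j + (\<epsilon> * (2 * C))\<^sup>2)) = 1 + (\<epsilon> * (2 * C))\<^sup>2"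
  proof -
    have "(\<Sum>j<m. p (a @ [j]) * (1 + \<epsilon> * d j + (\<epsilon> * (2 * C))\<^sup>2)) = (\<Sum>j<m. p (a @ [j])) * (1 + K - \<epsilon> * M) + \<epsilon> * (\<Sum>j<m. p (a @ [j]) * g (a @ [j]))"
    if "K = (\<epsilon> * (2 * C))\<^sup>2" "M = mean p g a" for K M
    unfolding d_def that[symmetric]
    by (simp add: sum.distrib sum_subtractf sum_distrib_left sum_distrib_right algebra_simps)
    from this[OF refl refl] show ?thesis
      using a by (simp add: p_sum mean_def[symmetric])
  qed
  also have "\<dots> \<le> exp ((\<epsilon> * (2 * C))\<^sup>2)" by (rule exp_ge_add_one_self)
  finally show ?thesis by (simp add: d_def)
qed

text \<open>The deviations are martingale differences for the filtration by prefixes, so the exponential moment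
gains at most one factor for each new letter.\<close>

lemma exp_moment_le:
  assumes g: "\<And>w. w \<in> blocks \<Longrightarrow> \<bar>g w\<bar> \<le> C" and \<epsilon>: "\<epsilon> \<ge> 0" "\<epsilon> * (2 * C) \<le> 1"
  shows "(\<Sum>w\<in>words m n. chain_weight w * exp (\<epsilon> * (\<Sum>k=1..n. deviation g (extend w) k))) \<le> exp ((\<epsilon> * (2 * C))\<^sup>2) ^ n"
proof (induction n)
  case 0
  then show ?case by (simp add: words_0 chain_weight_def)
next
  case (Suc n)
  have "(\<Sum>w\<in>words m (Suc n). chain_weight w * exp (\<epsilon> * (\<Sum>k=1..Suc n. deviation g (extend w) k)))
     = (\<Sum>w\<in>words m n. \<Sum>j<m. chain_weight (w @ [j]) * exp (\<epsilon> * (\<Sum>k=1..Suc n. deviation g (extend (w @ [j])) k)))"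
    by (rule sum_words_Suc)
  also have "\<dots> \<le> (\<Sum>w\<in>words m n. chain_weight w * exp (\<epsilon> * (\<Sum>k=1..n. deviation g (extend w) k)) * exp ((\<epsilon> * (2 * C))\<^sup>2))"
  proof (intro sum_mono)
    fix w assume w: "w \<in> words m n"
    then have len: "length w = n" and lists: "w \<in> lists {..<m}" by (auto simp: words_def)
    let ?a = "past (extend w) (Suc n)"
    have a: "?a \<in> pasts" by (intro past_in_pasts extend_in_seq_space lists)
    have deviation: "(\<Sum>k=1..Suc n. deviation g (extend (w @ [j])) k) = (\<Sum>k=1..n. deviation g (extend w) k) + (g (?a @ [j]) - mean p g ?a)" for j
    proof -
      have "(\<Sum>k=1..n. deviation g (extend (w @ [j])) k) = (\<Sum>k=1..n. deviation g (extend w) k)"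
        by (intro sum.cong refl) (auto simp: deviation_def window_extend_snoc len)
      then show ?thesis using window_extend_snoc(2)[of w j] window_extend_snoc(3)[of "Suc n" w j] len by (simp add: deviation_def)
    qed
    have "(\<Sum>j<m. chain_weight (w @ [j]) * exp (\<epsilon> * (\<Sum>k=1..Suc n. deviation g (extend (w @ [j])) k)))
        = chain_weight w * exp (\<epsilon> * (\<Sum>k=1..n. deviation g (extend w) k)) * (\<Sum>j<m. p (?a @ [j]) * exp (\<epsilon> * (g (?a @ [j]) - mean p g ?a)))"
    proof -
      define S where "S = (\<Sum>k=1..n. deviation g (extend w) k)"
      show ?thesis
        unfolding deviation S_def[symmetric] sum_distrib_left
        by (intro sum.cong refl) (simp add: chain_weight_snoc len distrib_left[of _ S] exp_add mult_ac)
    qed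
    also have "\<dots> \<le> chain_weight w * exp (\<epsilon> * (\<Sum>k=1..n. deviation g (extend w) k)) * exp ((\<epsilon> * (2 * C))\<^sup>2)"
      using weight_nonneg[OF lists] by (intro mult_left_mono exp_moment_step a g \<epsilon>) auto
    finally show "(\<Sum>j<m. chain_weight (w @ [j]) * exp (\<epsilon> * (\<Sum>k=1..Suc n. deviation g (extend (w @ [j])) k))) \<le> \<dots>" .
  qed
  also have "\<dots> = (\<Sum>w\<in>words m n. chain_weight w * exp (\<epsilon> * (\<Sum>k=1..n. deviation g (extend w) k))) * exp ((\<epsilon> * (2 * C))\<^sup>2)"
    by (rule sum_distrib_right[symmetric])
  also have "\<dots> \<le> exp ((\<epsilon> * (2 * C))\<^sup>2) ^ n * exp ((\<epsilon> * (2 * C))\<^sup>2)"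
    by (intro mult_right_mono Suc) auto
  finally show ?case unfolding power_Suc2 .
qed

text \<open>Markov's inequality for the exponential moment bounds the weight of the bad words of length \<open>n\<close> by
\<open>exp (- \<epsilon> \<delta> n / 2)\<close>, which is summable.\<close>

lemma weight_null_large_deviation:
  assumes \<delta>: "\<delta> > 0"
  shows "weight_null {x \<in> seq_space m. \<exists>\<^sub>F n in sequentially. (\<Sum>k=1..n. deviation g x k) > \<delta> * real n}"
proof -
  obtain C where C: "C > 0" "\<And>w. w \<in> blocks \<Longrightarrow> \<bar>g w\<bar> \<le> C" using bounded_on_blocks by blast
  \<comment> \<open>The first bound makes the exponential moment estimate applicable; the second one makes its
    growth rate at most half of the gain \<open>\<epsilon> \<delta>\<close>.\<close>
  define \<epsilon> where "\<epsilon> = min (1 / (2 * C)) (\<delta> / (8 * C\<^sup>2))"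
  have \<epsilon>: "\<epsilon> > 0" "\<epsilon> * (2 * C) \<le> 1" "\<epsilon> \<le> \<delta> / (8 * C\<^sup>2)"
    using C(1) \<delta> by (auto simp: \<epsilon>_def min_def field_simps)
  have "(\<epsilon> * (2 * C))\<^sup>2 = \<epsilon> * (\<epsilon> * (4 * C\<^sup>2))" by (simp add: power2_eq_square)
  also have "\<dots> \<le> \<epsilon> * (\<delta> / (8 * C\<^sup>2) * (4 * C\<^sup>2))"
    using \<epsilon> by (intro mult_left_mono mult_right_mono) auto
  also have "\<dots> = \<epsilon> * \<delta> / 2" using C(1) by simp
  finally have rate: "(\<epsilon> * (2 * C))\<^sup>2 \<le> \<epsilon> * \<delta> / 2" .
  define B where "B n = {w \<in> words m n. (\<Sum>k=1..n. deviation g (extend w) k) > \<delta> * real n}" for n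
  have upper: "(\<Sum>w\<in>B n. chain_weight w) \<le> exp (- (\<epsilon> * \<delta> / 2)) ^ n" for n
  proof -
    have nonneg: "0 \<le> chain_weight w" if "w \<in> words m n" for w
      using that by (intro weight_nonneg) (auto simp: words_def)
    have "(\<Sum>w\<in>B n. chain_weight w) \<le> (\<Sum>w\<in>B n. chain_weight w * exp (\<epsilon> * (\<Sum>k=1..n. deviation g (extend w) k)) * exp (- \<epsilon> * \<delta>) ^ n)"
    proof (intro sum_mono)
      fix w assume w: "w \<in> B n"
      have "0 \<le> \<epsilon> * ((\<Sum>k=1..n. deviation g (extend w) k) - \<delta> * real n)"
        using w \<epsilon> by (intro mult_nonneg_nonneg) (auto simp: B_def)
      then have "1 \<le> exp (\<epsilon> * (\<Sum>k=1..n. deviation g (extend w) k)) * exp (- \<epsilon> * \<delta>) ^ n"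
        by (simp add: exp_of_nat_mult[symmetric] mult_exp_exp algebra_simps)
      from mult_left_mono[OF this, of "chain_weight w"] show "chain_weight w \<le> chain_weight w * exp (\<epsilon> * (\<Sum>k=1..n. deviation g (extend w) k)) * exp (- \<epsilon> * \<delta>) ^ n"
        using w nonneg[of w] by (simp add: B_def mult.assoc)
    qed
    also have "\<dots> \<le> (\<Sum>w\<in>words m n. chain_weight w * exp (\<epsilon> * (\<Sum>k=1..n. deviation g (extend w) k)) * exp (- \<epsilon> * \<delta>) ^ n)"
      by (intro sum_mono2) (auto simp: B_def nonneg)
    also have "\<dots> \<le> exp ((\<epsilon> * (2 * C))\<^sup>2) ^ n * exp (- \<epsilon> * \<delta>) ^ n"
      unfolding sum_distrib_right[symmetric] using \<epsilon> C by (intro mult_right_mono exp_moment_le) auto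
    also have "\<dots> = exp ((\<epsilon> * (2 * C))\<^sup>2 - \<epsilon> * \<delta>) ^ n"
      by (simp add: power_mult_distrib[symmetric] mult_exp_exp)
    also have "\<dots> \<le> exp (- (\<epsilon> * \<delta> / 2)) ^ n"
      using rate by (intro power_mono) auto
    finally show ?thesis .
  qed
  have nonneg: "0 \<le> (\<Sum>w\<in>B n. chain_weight w)" for n
    by (intro sum_nonneg weight_nonneg) (auto simp: B_def words_def)
  have "summable (\<lambda>n. exp (- (\<epsilon> * \<delta> / 2)) ^ n)"
    using \<epsilon>(1) \<delta> by (intro summable_geometric) simp
  then have "summable (\<lambda>n. \<Sum>w\<in>B n. chain_weight w)"
    by (rule summable_comparison_test') (simp only: real_norm_def abs_of_nonneg[OF nonneg] upper)
  then have null: "weight_null {x. \<exists>\<^sub>F n in sequentially. seq_prefix x n \<in> B n}"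
    by (intro borel_cantelli) (auto simp: B_def)
  have same: "(\<Sum>k=1..n. deviation g (extend (seq_prefix x n)) k) = (\<Sum>k=1..n. deviation g x k)" for x n
  proof (intro sum.cong refl)
    fix k assume k: "k \<in> {1..n}"
    then have "window (extend (seq_prefix x n)) k = window x k" "past (extend (seq_prefix x n)) k = past x k"
      by (auto intro!: window_cong past_cong simp: extend_prefix)
    then show "deviation g (extend (seq_prefix x n)) k = deviation g x k" by (simp add: deviation_def)
  qed
  show ?thesis
  proof (rule weight_null_subset[OF null], clarify)
    fix x assume x: "x \<in> seq_space m" and *: "\<exists>\<^sub>F n in sequentially. (\<Sum>k=1..n. deviation g x k) > \<delta> * real n"
    have "seq_prefix x n \<in> B n" if "(\<Sum>k=1..n. deviation g x k) > \<delta> * real n" for n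
      using that x by (simp add: B_def seq_prefix_in_words same[unfolded One_nat_def])
    with * show "\<exists>\<^sub>F n in sequentially. seq_prefix x n \<in> B n"
      by (rule frequently_elim1)
  qed
qed

definition typical :: "((nat \<Rightarrow> nat) \<Rightarrow> bool) \<Rightarrow> bool" where
  "typical P \<longleftrightarrow> weight_null {x \<in> seq_space m. \<not> P x}"

lemma typical_mono:
  "typical P \<Longrightarrow> (\<And>x. x \<in> seq_space m \<Longrightarrow> P x \<Longrightarrow> Q x) \<Longrightarrow> typical Q"
  unfolding typical_def by (erule weight_null_subset) auto

lemma typical_all: "(\<And>i::nat. typical (P i)) \<Longrightarrow> typical (\<lambda>x. \<forall>i. P i x)"
  unfolding typical_def by (drule weight_null_UN) (erule weight_null_subset, auto)

lemma typical_conj: "typical P \<Longrightarrow> typical Q \<Longrightarrow> typical (\<lambda>x. P x \<and> Q x)"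
  unfolding typical_def by (drule (1) weight_null_Un) (erule weight_null_subset, auto)

lemma typical_not_null:
  assumes "typical P"
  shows "\<not> weight_null {x \<in> seq_space m. P x}"
proof
  assume "weight_null {x \<in> seq_space m. P x}"
  from weight_null_Un[OF this assms[unfolded typical_def]] have "weight_null (seq_space m)"
    by (rule weight_null_subset) auto
  with not_weight_null_seq_space show False by contradiction
qed

lemma deviation_uminus: "deviation (\<lambda>w. - g w) x k = - deviation g x k"
  by (simp add: deviation_def mean_def sum_negf)

lemma typical_deviation:
  "typical (\<lambda>x. (\<lambda>n. (\<Sum>k=1..n. deviation g x k) / real n) \<longlonglongrightarrow> 0)"
proof -
  have upper: "typical (\<lambda>x. \<forall>i. eventually (\<lambda>n. (\<Sum>k=1..n. deviation g x k) \<le> 1 / real (Suc i) * real n) sequentially)" for g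
    using weight_null_large_deviation[of "1 / real (Suc _)" g]
    by (intro typical_all) (simp add: typical_def not_eventually not_le)
  have "typical (\<lambda>x. (\<forall>i. eventually (\<lambda>n. (\<Sum>k=1..n. deviation g x k) \<le> 1 / real (Suc i) * real n) sequentially)
      \<and> (\<forall>i. eventually (\<lambda>n. (\<Sum>k=1..n. deviation (\<lambda>w. - g w) x k) \<le> 1 / real (Suc i) * real n) sequentially))"
    by (intro typical_conj upper)
  then show ?thesis
  proof (rule typical_mono)
    fix x assume *: "(\<forall>i. eventually (\<lambda>n. (\<Sum>k=1..n. deviation g x k) \<le> 1 / real (Suc i) * real n) sequentially)
      \<and> (\<forall>i. eventually (\<lambda>n. (\<Sum>k=1..n. deviation (\<lambda>w. - g w) x k) \<le> 1 / real (Suc i) * real n) sequentially)"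
    show "(\<lambda>n. (\<Sum>k=1..n. deviation g x k) / real n) \<longlonglongrightarrow> 0"
    proof (rule tendstoI)
      fix e :: real assume "e > 0"
      then obtain i where i: "1 / real (Suc i) < e" using nat_approx_posE by blast
      have "eventually (\<lambda>n. (\<Sum>k=1..n. deviation g x k) \<le> 1 / real (Suc i) * real n) sequentially"
           "eventually (\<lambda>n. - (\<Sum>k=1..n. deviation g x k) \<le> 1 / real (Suc i) * real n) sequentially"
        using * by (auto simp: deviation_uminus sum_negf)
      then show "eventually (\<lambda>n. dist ((\<Sum>k=1..n. deviation g x k) / real n) 0 < e) sequentially"
        using eventually_gt_at_top[of 0]
      proof eventually_elim
        case (elim n)
        then have "\<bar>(\<Sum>k=1..n. deviation g x k)\<bar> \<le> 1 / real (Suc i) * real n" by linarith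
        then have "\<bar>(\<Sum>k=1..n. deviation g x k)\<bar> / real n \<le> 1 / real (Suc i)"
          using elim(3) by (simp only: pos_divide_le_eq of_nat_0_less_iff)
        with i show ?case by (simp add: abs_divide)
      qed
    qed
  qed
qed

end

section \<open>Long-term means\<close>

context telescoping
begin

text \<open>The influence of one step of a chain: \<open>backward p f a\<close> is the expected value of \<open>f\<close> at the next past,
given the past \<open>a\<close>.\<close>

definition backward :: "(nat list \<Rightarrow> real) \<Rightarrow> (nat list \<Rightarrow> real) \<Rightarrow> nat list \<Rightarrow> real" where
  "backward p f = mean p (\<lambda>w. f (trunc w))"

text \<open>Among the integers, a proportion \<open>(1 - 1/q) q\<^sup>-\<^sup>i\<close> stands at position \<open>i\<close> of its chain, and \<open>f\<close> of the
past has mean \<open>(backward p ^^ i) f []\<close> there.\<close>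

definition long_term_mean :: "(nat list \<Rightarrow> real) \<Rightarrow> (nat list \<Rightarrow> real) \<Rightarrow> real" where
  "long_term_mean p f = (1 - 1 / real q) * (\<Sum>i. (1 / real q) ^ i * (backward p ^^ i) f [])"

lemma mean_cong:
  "a \<in> pasts \<Longrightarrow> (\<And>w. w \<in> blocks \<Longrightarrow> g w = h w) \<Longrightarrow> mean p g a = mean p h a"
  unfolding mean_def by (intro sum.cong refl) (simp add: snoc_in_blocks)

lemma backward_cong:
  assumes "a \<in> pasts" "\<And>b. b \<in> pasts \<Longrightarrow> f b = g b"
  shows "backward p f a = backward p g a"
  unfolding backward_def
  by (rule mean_cong[OF assms(1)]) (rule assms(2), rule trunc_in_pasts)

lemma iterate_back_cong:
  assumes "\<And>a. a \<in> pasts \<Longrightarrow> f a = g a" "a \<in> pasts"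
  shows "(backward p ^^ i) f a = (backward p ^^ i) g a"
  using assms(2)
proof (induction i arbitrary: a)
  case (Suc i)
  then show ?case by (simp, intro backward_cong)
qed (use assms in simp)

lemma length_window_le: "length (window x k) \<le> l"
proof (induction k rule: less_induct)
  case (less k)
  show ?case
  proof (cases "q dvd k \<and> 0 < k")
    case True
    then have "k div q < k" using q_ge_2 by auto
    from less.IH[OF this] show ?thesis
      using True l_ge_2 by (auto simp: window_eq[of x k] past_def[of x k] trunc_def)
  qed (use l_ge_2 in \<open>auto simp: window_eq[of x k] past_def[of x k]\<close>)
qed

lemma long_term_mean_cong: "(\<And>a. a \<in> pasts \<Longrightarrow> f a = g a) \<Longrightarrow> long_term_mean p f = long_term_mean p g"
  unfolding long_term_mean_def by (simp add: iterate_back_cong[of f g])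

lemma iterate_back_linear:
  "(backward p ^^ i) (\<lambda>a. c * f a + d * g a) = (\<lambda>a. c * (backward p ^^ i) f a + d * (backward p ^^ i) g a)"
  by (induction i) (auto simp: backward_def mean_def sum_distrib_left sum.distrib algebra_simps)

lemma full_window_iff:
  assumes "i < l"
  shows "k \<ge> 1 \<Longrightarrow> i < length (window x k) \<longleftrightarrow> q ^ i dvd k"
  using assms
proof (induction i arbitrary: k)
  case 0
  then show ?case by (simp add: window_eq[of x k])
next
  case (Suc i)
  show ?case
  proof (cases "q dvd k")
    case True
    then obtain k' where k': "k = q * k'" by blast
    have "k' \<ge> 1" using Suc.prems k' by (cases k') auto
    have "Suc i < length (window x k) \<longleftrightarrow> i < length (trunc (window x k'))"
      unfolding k' using Suc.prems k' q_ge_2 by (simp add: window_eq[of x "q * k'"] past_def[of x "q * k'"])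
    also have "\<dots> \<longleftrightarrow> i < length (window x k')"
      using Suc.prems length_window_le[of x k'] by (auto simp: trunc_def)
    also have "\<dots> \<longleftrightarrow> q ^ i dvd k'" using Suc.IH \<open>k' \<ge> 1\<close> Suc.prems by simp
    finally show ?thesis using k' q_ge_2 by simp
  next
    case False
    then have "\<not> q ^ Suc i dvd k" by (metis dvd_mult_left power_Suc)
    with False show ?thesis by (simp add: window_eq[of x k] past_def[of x k])
  qed
qed

lemma window_suffix:
  assumes "k \<ge> 1" "i < l"
  shows "\<exists>u. window x (k * q ^ i) = u @ map (\<lambda>j. x (k * q ^ j)) [0..<Suc i]"
  using assms(2)
proof (induction i)
  case 0
  then show ?case by (simp add: window_eq[of x k])
next
  case (Suc i)
  then obtain u where u: "window x (k * q ^ i) = u @ map (\<lambda>j. x (k * q ^ j)) [0..<Suc i]" by auto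
  have "\<exists>u'. trunc (window x (k * q ^ i)) = u' @ map (\<lambda>j. x (k * q ^ j)) [0..<Suc i]"
  proof (cases "length (window x (k * q ^ i)) = l")
    case True
    then have "u \<noteq> []" using u Suc.prems by auto
    then show ?thesis using True u by (simp add: trunc_def del: upt_Suc)
  qed (simp add: trunc_def u)
  then obtain u' where u': "trunc (window x (k * q ^ i)) = u' @ map (\<lambda>j. x (k * q ^ j)) [0..<Suc i]" by blast
  have "k * q ^ Suc i div q = k * q ^ i" "q dvd k * q ^ Suc i" "k * q ^ Suc i > 0"
    using assms(1) q_ge_2 by auto
  then have "past x (k * q ^ Suc i) = u' @ map (\<lambda>j. x (k * q ^ j)) [0..<Suc i]"
    unfolding past_def u'[symmetric] by simp
  then have "window x (k * q ^ Suc i) = u' @ map (\<lambda>j. x (k * q ^ j)) [0..<Suc (Suc i)]"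
    by (simp add: window_eq[of x "k * q ^ Suc i"] del: power_Suc)
  then show ?case ..
qed

text \<open>Extends a function of words of length \<open>l\<close> to all windows. Windows of full length are those at multiples of
\<open>q ^ (l - 1)\<close>, and they are the arguments of \<open>\<phi>\<close>.\<close>

definition full_block :: "(nat list \<Rightarrow> real) \<Rightarrow> nat list \<Rightarrow> real" where
  "full_block f w = (if length w = l then f w else 0)"

lemma sum_full_window:
  "(\<Sum>k=1..n. full_block f (window x k)) = (\<Sum>k=1..n div q ^ (l - 1). f (map (\<lambda>i. x (k * q ^ i)) [0..<l]))"
proof -
  let ?d = "q ^ (l - 1)"
  have d: "?d > 0" using q_ge_2 by simp
  have window: "window x (k * ?d) = map (\<lambda>i. x (k * q ^ i)) [0..<l]" if k: "k \<ge> 1" for k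
  proof -
    obtain u where u: "window x (k * ?d) = u @ map (\<lambda>i. x (k * q ^ i)) [0..<Suc (l - 1)]"
      using window_suffix[OF k, of "l - 1" x] l_ge_2 by auto
    have "\<not> length (window x (k * ?d)) > l"
      using length_window_le by (simp add: not_less)
    with u have "u = []" using l_ge_2 by simp
    with u show ?thesis using l_ge_2 by simp
  qed
  have "(\<Sum>k=1..n. full_block f (window x k)) = (\<Sum>k\<in>{k\<in>{1..n}. ?d dvd k}. f (window x k))"
  proof (intro sum.mono_neutral_cong_right ballI)
    fix k assume k: "k \<in> {1..n} - {k\<in>{1..n}. ?d dvd k}"
    then have "\<not> l - 1 < length (window x k)" using full_window_iff[of "l - 1" k x] l_ge_2 by auto
    then show "full_block f (window x k) = 0" using l_ge_2 by (auto simp: full_block_def)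
  next
    fix k assume k: "k \<in> {k\<in>{1..n}. ?d dvd k}"
    then obtain j where j: "k = j * ?d" by (metis (no_types, lifting) dvd_def mem_Collect_eq mult.commute)
    with k have "j \<ge> 1" by (cases j) auto
    then show "full_block f (window x k) = f (window x k)" using j window by (simp add: full_block_def)
  qed auto
  also have "\<dots> = (\<Sum>k=1..n div ?d. f (window x (k * ?d)))"
    by (rule sum.reindex_bij_witness[of _ "\<lambda>k. k * ?d" "\<lambda>k. k div ?d"])
       (use d in \<open>auto simp: less_eq_div_iff_mult_less_eq div_le_mono Suc_le_eq div_greater_zero_iff dvd_imp_le\<close>)
  also have "\<dots> = (\<Sum>k=1..n div ?d. f (map (\<lambda>i. x (k * q ^ i)) [0..<l]))"
    using window by (intro sum.cong refl) auto
  finally show ?thesis .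
qed

lemma level_set_if_average:
  assumes x: "x \<in> seq_space m"
    and lim: "(\<lambda>n. (\<Sum>k=1..n. full_block \<phi> (window x k)) / real n) \<longlonglongrightarrow> \<beta>"
  shows "x \<in> level_set m l q \<phi> (real q ^ (l - 1) * \<beta>)"
proof -
  let ?d = "q ^ (l - 1)"
  have d: "?d > 0" using q_ge_2 by simp
  have "filterlim (\<lambda>N. N * ?d) at_top sequentially"
    using d by (intro filterlim_subseq) (auto simp: strict_mono_def)
  from filterlim_compose[OF lim this]
  have "(\<lambda>N. real ?d * ((\<Sum>k=1..N * ?d. full_block \<phi> (window x k)) / real (N * ?d))) \<longlonglongrightarrow> real ?d * \<beta>"
    by (intro tendsto_mult tendsto_const)
  moreover have "real ?d * ((\<Sum>k=1..N * ?d. full_block \<phi> (window x k)) / real (N * ?d))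
      = 1 / real N * (\<Sum>k=1..N. \<phi> (map (\<lambda>i. x (k * q ^ i)) [0..<l]))" for N
    unfolding sum_full_window using d q_ge_2 by (simp add: field_simps)
  ultimately show ?thesis using x by (simp add: level_set_def)
qed

end

section \<open>The level set carried by a kernel\<close>

lemma hausdorff_dim_mono: "A \<subseteq> B \<Longrightarrow> hausdorff_dim M d A \<le> hausdorff_dim M d B"
proof -
  assume AB: "A \<subseteq> B"
  have pre: "hausdorff_premeasure M d t \<delta> A \<le> hausdorff_premeasure M d t \<delta> B" for t \<delta>
    unfolding hausdorff_premeasure_def using AB by (intro INF_superset_mono) auto
  have "hausdorff_measure M d t A \<le> hausdorff_measure M d t B" for t
    unfolding hausdorff_measure_def by (intro SUP_mono' pre)
  then have "hausdorff_measure M d t B = 0 \<Longrightarrow> hausdorff_measure M d t A = 0" for t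
    by (metis le_zero_eq)
  then show ?thesis unfolding hausdorff_dim_def by (intro INF_superset_mono) auto
qed

context transition_kernel
begin

lemma abs_iterate_back_le:
  assumes "\<And>a. a \<in> pasts \<Longrightarrow> \<bar>f a\<bar> \<le> C" "a \<in> pasts"
  shows "\<bar>(backward p ^^ i) f a\<bar> \<le> C"
  using assms(2)
proof (induction i arbitrary: a)
  case (Suc i)
  then show ?case by (auto simp: backward_def snoc_in_blocks trunc_in_pasts intro!: abs_mean_le)
qed (use assms in simp)

lemma summable_long_term_mean: "summable (\<lambda>i. (1 / real q) ^ i * (backward p ^^ i) f [])"
proof -
  obtain C where "C > 0" "\<And>w. w \<in> blocks \<Longrightarrow> \<bar>f w\<bar> \<le> C" using bounded_on_blocks by blast
  then have bound: "\<bar>(backward p ^^ i) f []\<bar> \<le> C" for i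
    by (intro abs_iterate_back_le) (auto simp: pasts_subset_blocks)
  have "summable (\<lambda>i. (1 / real q) ^ i * C)"
    using q_ge_2 by (intro summable_mult2 summable_geometric) simp
  then show ?thesis
    by (rule summable_comparison_test') (auto simp: abs_mult intro!: mult_left_mono divide_right_mono bound)
qed

text \<open>The limit counterpart of \<open>sum_past\<close>.\<close>

lemma long_term_mean_step: "long_term_mean p f = (1 - 1 / real q) * f [] + 1 / real q * long_term_mean p (backward p f)"
proof -
  have "(\<Sum>i. (1 / real q) ^ i * (backward p ^^ i) f []) = (\<Sum>i. (1 / real q) ^ Suc i * (backward p ^^ Suc i) f []) + f []"
    using suminf_split_head[OF summable_long_term_mean[of f]] by simp
  also have "(\<Sum>i. (1 / real q) ^ Suc i * (backward p ^^ Suc i) f []) = 1 / real q * (\<Sum>i. (1 / real q) ^ i * (backward p ^^ i) (backward p f) [])"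
    by (subst suminf_mult[OF summable_long_term_mean, symmetric]) (simp add: funpow_swap1 mult_ac)
  finally have split: "(\<Sum>i. (1 / real q) ^ i * (backward p ^^ i) f []) =
      1 / real q * (\<Sum>i. (1 / real q) ^ i * (backward p ^^ i) (backward p f) []) + f []" .
  have "(1 - c) * (c * s + t) = (1 - c) * t + c * ((1 - c) * s)" for c s t :: real
    by (simp add: algebra_simps)
  then show ?thesis unfolding long_term_mean_def split .
qed

lemma long_term_mean_linear: "long_term_mean p (\<lambda>a. c * f a + d * g a) = c * long_term_mean p f + d * long_term_mean p g"
proof -
  have "(\<Sum>i. (1 / real q) ^ i * (backward p ^^ i) (\<lambda>a. c * f a + d * g a) [])
    = (\<Sum>i. c * ((1 / real q) ^ i * (backward p ^^ i) f []) + d * ((1 / real q) ^ i * (backward p ^^ i) g []))"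
    by (simp add: iterate_back_linear algebra_simps)
  also have "\<dots> = c * (\<Sum>i. (1 / real q) ^ i * (backward p ^^ i) f []) + d * (\<Sum>i. (1 / real q) ^ i * (backward p ^^ i) g [])"
    by (simp add: suminf_add[symmetric] suminf_mult summable_mult summable_long_term_mean)
  finally show ?thesis unfolding long_term_mean_def by (simp add: algebra_simps)
qed

lemma abs_long_term_mean_le:
  assumes "\<And>a. a \<in> pasts \<Longrightarrow> \<bar>f a\<bar> \<le> C"
  shows "\<bar>long_term_mean p f\<bar> \<le> C"
proof -
  have bound: "\<bar>(backward p ^^ i) f []\<bar> \<le> C" for i
    using assms by (intro abs_iterate_back_le) auto
  have geo: "(\<lambda>i. (1 / real q) ^ i * C) sums (1 / (1 - 1 / real q) * C)"
    using q_ge_2 by (intro sums_mult2 geometric_sums) simp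
  have "norm ((1 / real q) ^ i * (backward p ^^ i) f []) \<le> (1 / real q) ^ i * C" for i
    using mult_left_mono[OF bound[of i], of "(1 / real q) ^ i"] by (simp add: abs_mult)
  from norm_suminf_le[OF this sums_summable[OF geo]]
  have "\<bar>\<Sum>i. (1 / real q) ^ i * (backward p ^^ i) f []\<bar> \<le> (\<Sum>i. (1 / real q) ^ i * C)"
    by simp
  also have "\<dots> = 1 / (1 - 1 / real q) * C" using geo by (rule sums_unique[symmetric])
  finally have "(1 - 1 / real q) * \<bar>\<Sum>i. (1 / real q) ^ i * (backward p ^^ i) f []\<bar> \<le> (1 - 1 / real q) * (1 / (1 - 1 / real q) * C)"
    using q_ge_2 by (intro mult_left_mono) auto
  moreover have "(1 - 1 / real q) * (1 / (1 - 1 / real q) * C) = C" "\<bar>1 - 1 / real q\<bar> = 1 - 1 / real q"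
    using q_ge_2 by auto
  ultimately show ?thesis unfolding long_term_mean_def abs_mult by simp
qed

text \<open>Let \<open>A i n\<close> be the average up to \<open>n\<close> of the \<open>i\<close>-th iterate \<open>h i\<close> at the pasts. By \<open>sum_past\<close>, \<open>A i n\<close>
is, up to the deviations, a combination of \<open>h i []\<close> and \<open>A (i + 1) (n/q)\<close> in which the latter has
coefficient about \<open>1/q\<close>. The same recursion, with \<open>1/q\<close> exactly, holds for the claimed limits. So
the asymptotic error for \<open>i\<close> is at most \<open>1/q\<close> times that for \<open>i + 1\<close>, and all errors are bounded by the same constant.\<close>

lemma average_past_tendsto:
  assumes x: "x \<in> seq_space m"
    and deviation: "\<And>i. (\<lambda>n. (\<Sum>k=1..n. deviation (\<lambda>w. (backward p ^^ i) f (trunc w)) x k) / real n) \<longlonglongrightarrow> 0"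
  shows "(\<lambda>n. (\<Sum>k=1..n. f (past x k)) / real n) \<longlonglongrightarrow> long_term_mean p f"
proof -
  define h where "h i = (backward p ^^ i) f" for i
  define A where "A i n = (\<Sum>k=1..n. h i (past x k)) / real n" for i n
  define D where "D i n = (\<Sum>k=1..n. deviation (\<lambda>w. h i (trunc w)) x k) / real n" for i n
  define r where "r n = real (n div q) / real n" for n
  define L where "L i = long_term_mean p (h i)" for i
  obtain C where C: "C > 0" "\<And>w. w \<in> blocks \<Longrightarrow> \<bar>f w\<bar> \<le> C" using bounded_on_blocks by blast
  then have h: "\<bar>h i a\<bar> \<le> C" if "a \<in> pasts" for i a
    using that unfolding h_def by (intro abs_iterate_back_le) (auto simp: pasts_subset_blocks)
  have L: "\<bar>L i\<bar> \<le> C" for i unfolding L_def by (intro abs_long_term_mean_le h)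
  have L_step: "L i = (1 - 1 / real q) * h i [] + 1 / real q * L (Suc i)" for i
    unfolding L_def h_def by (subst long_term_mean_step) simp
  have A_bound: "\<bar>A i n\<bar> \<le> C" for i n
  proof (cases "n = 0")
    case False
    have "\<bar>\<Sum>k=1..n. h i (past x k)\<bar> \<le> (\<Sum>k=1..n. C)"
      by (intro order_trans[OF sum_abs] sum_mono h past_in_pasts x)
    with False show ?thesis by (simp add: A_def abs_divide field_simps)
  qed (use C in \<open>simp add: A_def\<close>)
  have A_step: "A i n = (1 - r n) * h i [] + r n * (D i (n div q) + A (Suc i) (n div q))" if n: "n > 0" for i n
  proof -
    have trunc: "(\<Sum>k=1..N. h i (trunc (window x k))) = real N * (D i N + A (Suc i) N)" for N
    proof -
      have "(\<Sum>k=1..N. h i (trunc (window x k)))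
          = (\<Sum>k=1..N. deviation (\<lambda>w. h i (trunc w)) x k) + (\<Sum>k=1..N. h (Suc i) (past x k))"
        by (simp add: deviation_def h_def backward_def sum_subtractf)
      then show ?thesis by (cases "N = 0") (auto simp: D_def A_def field_simps)
    qed
    have "(\<Sum>k=1..n. h i (past x k)) = real (n - n div q) * h i [] + real (n div q) * (D i (n div q) + A (Suc i) (n div q))"
      unfolding sum_past trunc ..
    then have "A i n = (real n - real (n div q)) / real n * h i [] + r n * (D i (n div q) + A (Suc i) (n div q))"
      by (simp add: A_def r_def add_divide_distrib of_nat_diff)
    then show ?thesis using n by (simp add: r_def diff_divide_distrib)
  qed
  have r_le: "r n \<le> 1 / real q" for n
    using of_nat_div_le_of_nat[of n q, where ?'a = real] q_ge_2 by (cases "n = 0") (auto simp: r_def field_simps)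
  have r_nonneg: "r n \<ge> 0" for n by (simp add: r_def)
  have r_lim: "r \<longlonglongrightarrow> 1 / real q" unfolding r_def by (rule tendsto_div_ratio)
  \<comment> \<open>The error bound is halved by each use of the recursion, since \<open>1/q \<le> 1/2\<close>.\<close>
  have main: "eventually (\<lambda>n. \<bar>A i n - L i\<bar> \<le> 2 * C / 2 ^ j + e) sequentially" if e: "e > 0" for i j e
    using e
  proof (induction j arbitrary: i e)
    case 0
    have "\<bar>A i n - L i\<bar> \<le> 2 * C / 2 ^ 0 + e" for n
      using A_bound[of i n] L[of i] 0 by simp
    then show ?case by simp
  next
    case (Suc j)
    have "eventually (\<lambda>n. \<bar>A (Suc i) n - L (Suc i)\<bar> \<le> 2 * C / 2 ^ j + e / 2) sequentially"
      using Suc by simp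
    then have e1: "eventually (\<lambda>n. \<bar>A (Suc i) (n div q) - L (Suc i)\<bar> \<le> 2 * C / 2 ^ j + e / 2) sequentially"
      using filterlim_div by (rule eventually_compose_filterlim)
    have "(\<lambda>n. D i (n div q)) \<longlonglongrightarrow> 0"
      using filterlim_compose[OF deviation[of i] filterlim_div] unfolding D_def h_def .
    then have e2: "eventually (\<lambda>n. \<bar>D i (n div q)\<bar> < e / 2) sequentially"
      using Suc.prems by (auto dest!: tendstoD[where e = "e / 2"])
    have "eventually (\<lambda>n. \<bar>r n - 1 / real q\<bar> < e / (4 * C)) sequentially"
      using tendstoD[OF r_lim, of "e / (4 * C)"] Suc.prems C(1) by (simp add: dist_real_def)
    with e1 e2 show ?case
      using eventually_gt_at_top[of 0]
    proof eventually_elim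
      case (elim n)
      define B where "B = D i (n div q) + (A (Suc i) (n div q) - L (Suc i))"
      \<comment> \<open>Split off the error of the coefficient \<open>r n\<close>, which tends to \<open>1/q\<close>.\<close>
      have eq: "A i n - L i = (1 / real q - r n) * (h i [] - L (Suc i)) + r n * B"
        unfolding A_step[OF elim(4)] L_step[of i] B_def by (simp add: algebra_simps)
      have "\<bar>h i [] - L (Suc i)\<bar> \<le> 2 * C" using h[of "[]" i] L[of "Suc i"] by simp
      then have "\<bar>(1 / real q - r n) * (h i [] - L (Suc i))\<bar> \<le> e / (4 * C) * (2 * C)"
        unfolding abs_mult using elim(3) by (intro mult_mono) auto
      then have 1: "\<bar>(1 / real q - r n) * (h i [] - L (Suc i))\<bar> \<le> e / 2"
        using C(1) by simp
      have "\<bar>r n\<bar> \<le> 1 / 2"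
      proof -
        have "1 / real q \<le> 1 / 2" using q_ge_2 by (intro divide_left_mono) auto
        then show ?thesis using r_le[of n] r_nonneg[of n] by linarith
      qed
      moreover have "\<bar>B\<bar> \<le> 2 * C / 2 ^ j + e" unfolding B_def using elim(1,2) by linarith
      ultimately have "\<bar>r n * B\<bar> \<le> 1 / 2 * (2 * C / 2 ^ j + e)"
        unfolding abs_mult by (intro mult_mono) auto
      also have "\<dots> = 2 * C / 2 ^ Suc j + e / 2" by (simp add: field_simps)
      finally have 2: "\<bar>r n * B\<bar> \<le> 2 * C / 2 ^ Suc j + e / 2" .
      show ?case
        unfolding eq using abs_triangle_ineq[of "(1 / real q - r n) * (h i [] - L (Suc i))" "r n * B"] 1 2
        by linarith
    qed
  qed
  have "A 0 \<longlonglongrightarrow> L 0"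
  proof (rule tendstoI)
    fix e :: real assume e: "e > 0"
    obtain j where "(1/2::real) ^ j < e / (4 * C)"
      using real_arch_pow_inv[of "e / (4 * C)" "1/2"] e C(1) by auto
    then have j: "2 * C / 2 ^ j < e / 2" using C(1) by (simp add: field_simps power_divide)
    show "eventually (\<lambda>n. dist (A 0 n) (L 0) < e) sequentially"
      using main[of "e / 4" 0 j] by (rule eventually_mono) (use e j in \<open>auto simp: dist_real_def\<close>)
  qed
  then show ?thesis by (simp add: A_def[abs_def] L_def h_def)
qed

lemma typical_average_past:
  "typical (\<lambda>x. (\<lambda>n. (\<Sum>k=1..n. f (past x k)) / real n) \<longlonglongrightarrow> long_term_mean p f)"
proof (rule typical_mono)
  show "typical (\<lambda>x. \<forall>i. (\<lambda>n. (\<Sum>k=1..n. deviation (\<lambda>w. (backward p ^^ i) f (trunc w)) x k) / real n) \<longlonglongrightarrow> 0)"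
    by (intro typical_all typical_deviation)
qed (blast intro: average_past_tendsto)

lemma typical_average_window:
  "typical (\<lambda>x. (\<lambda>n. (\<Sum>k=1..n. g (window x k)) / real n) \<longlonglongrightarrow> long_term_mean p (mean p g))"
proof (rule typical_mono[OF typical_conj[OF typical_deviation[of g] typical_average_past[of "mean p g"]]])
  fix x assume "(\<lambda>n. (\<Sum>k=1..n. deviation g x k) / real n) \<longlonglongrightarrow> 0 \<and>
      (\<lambda>n. (\<Sum>k=1..n. mean p g (past x k)) / real n) \<longlonglongrightarrow> long_term_mean p (mean p g)"
  then have "(\<lambda>n. (\<Sum>k=1..n. deviation g x k) / real n + (\<Sum>k=1..n. mean p g (past x k)) / real n) \<longlonglongrightarrow> 0 + long_term_mean p (mean p g)"
    by (intro tendsto_add) auto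
  then show "(\<lambda>n. (\<Sum>k=1..n. g (window x k)) / real n) \<longlonglongrightarrow> long_term_mean p (mean p g)"
    by (simp add: deviation_def sum_subtractf add_divide_distrib[symmetric])
qed

text \<open>A typical point satisfies the law of large numbers for \<open>\<phi>\<close>, hence lies in the level set, and that for
\<open>- ln p\<close>, hence has the local dimension given by the entropy. Where \<open>p\<close> vanishes, the convention
\<open>ln 0 = 0\<close> keeps \<open>- ln p\<close> bounded, and the weight 0 is lighter than any bound.\<close>

lemma level_set_of_kernel:
  fixes \<phi> :: "nat list \<Rightarrow> real"
  defines "\<alpha> \<equiv> real q ^ (l - 1) * long_term_mean p (mean p (full_block \<phi>))"
  shows "level_set m l q \<phi> \<alpha> \<noteq> {}"
    and "ereal (long_term_mean p (mean p (\<lambda>w. - ln (p w))) / ln (real m)) \<le>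
      hausdorff_dim (seq_space m) (seq_dist m) (level_set m l q \<phi> \<alpha>)"
proof -
  let ?H = "long_term_mean p (mean p (\<lambda>w. - ln (p w)))"
  define E where "E = {x \<in> seq_space m. (\<lambda>n. (\<Sum>k=1..n. full_block \<phi> (window x k)) / real n) \<longlonglongrightarrow> long_term_mean p (mean p (full_block \<phi>))
     \<and> (\<lambda>n. (\<Sum>k=1..n. - ln (p (window x k))) / real n) \<longlonglongrightarrow> ?H}"
  have big: "\<not> weight_null E"
    unfolding E_def by (intro typical_not_null typical_conj typical_average_window)
  have sub: "E \<subseteq> level_set m l q \<phi> \<alpha>"
    unfolding E_def \<alpha>_def using level_set_if_average by blast
  have "E \<noteq> {}"
  proof
    assume "E = {}"
    moreover have "weight_null {}" unfolding weight_null_def by (auto intro!: exI[of _ "{}"])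
    ultimately show False using big by simp
  qed
  with sub show "level_set m l q \<phi> \<alpha> \<noteq> {}" by blast
  have "ereal (?H / ln (real m)) \<le> hausdorff_dim (seq_space m) (seq_dist m) E"
  proof (rule local_dim_le_hausdorff_dim[OF _ big])
    show "E \<subseteq> seq_space m" by (auto simp: E_def)
    fix x and e :: real assume x: "x \<in> E" and e: "e > 0"
    have "(\<lambda>n. (\<Sum>k=1..n. - ln (p (window x k))) / real n) \<longlonglongrightarrow> ?H"
      using x by (simp add: E_def)
    then have "eventually (\<lambda>n. ?H - e < (\<Sum>k=1..n. - ln (p (window x k))) / real n) sequentially"
      using e by (intro order_tendstoD) auto
    then show "eventually (\<lambda>n. chain_weight (seq_prefix x n) \<le> exp (- (real n * (?H - e)))) sequentially"
      using eventually_gt_at_top[of 0]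
    proof eventually_elim
      case (elim n)
      have pos: "0 \<le> p (window x k)" if "k \<in> {1..n}" for k
        using x that by (intro p_nonneg window_in_blocks) (auto simp: E_def)
      have "chain_weight (seq_prefix x n) = (\<Prod>k=1..n. p (window x k))"
        by (rule chain_weight_prefix)
      also have "\<dots> \<le> (\<Prod>k=1..n. exp (ln (p (window x k))))"
      proof (intro prod_mono conjI)
        fix k assume k: "k \<in> {1..n}"
        show "0 \<le> p (window x k)" by (rule pos[OF k])
        then show "p (window x k) \<le> exp (ln (p (window x k)))"
          by (cases "p (window x k) = 0") auto
      qed
      also have "\<dots> = exp (- (\<Sum>k=1..n. - ln (p (window x k))))"
        by (simp add: exp_sum sum_negf)
      also have "\<dots> \<le> exp (- (real n * (?H - e)))"
        using elim by (simp add: pos_less_divide_eq mult.commute)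
      finally show ?case .
    qed
  qed
  also have "\<dots> \<le> hausdorff_dim (seq_space m) (seq_dist m) (level_set m l q \<phi> \<alpha>)"
    by (intro hausdorff_dim_mono sub)
  finally show "ereal (?H / ln (real m)) \<le> hausdorff_dim (seq_space m) (seq_dist m) (level_set m l q \<phi> \<alpha>)" .
qed

end

section \<open>Continuity in the kernel\<close>

context telescoping
begin

lemma tendsto_iterate_backward:
  assumes P: "\<And>w. w \<in> blocks \<Longrightarrow> w \<noteq> [] \<Longrightarrow> ((\<lambda>s. P s w) \<longlongrightarrow> p w) F"
    and f: "\<And>a. a \<in> pasts \<Longrightarrow> ((\<lambda>s. f s a) \<longlongrightarrow> f0 a) F"
    and a: "a \<in> pasts"
  shows "((\<lambda>s. (backward (P s) ^^ i) (f s) a) \<longlongrightarrow> (backward p ^^ i) f0 a) F"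
  using a
proof (induction i arbitrary: a)
  case (Suc i)
  then show ?case
    by (auto simp: backward_def mean_def snoc_in_blocks trunc_in_pasts intro!: tendsto_sum tendsto_mult P)
qed (simp add: f)

text \<open>Each iterate is a polynomial in the values of the kernel, and Tannery's theorem exchanges the limit
with the geometrically dominated series.\<close>

lemma tendsto_long_term_mean:
  assumes F: "F \<noteq> bot" and kernel: "\<And>s. transition_kernel m l q (P s)"
    and P: "\<And>w. w \<in> blocks \<Longrightarrow> w \<noteq> [] \<Longrightarrow> ((\<lambda>s. P s w) \<longlongrightarrow> p w) F"
    and f: "\<And>a. a \<in> pasts \<Longrightarrow> ((\<lambda>s. f s a) \<longlongrightarrow> f0 a) F"
    and bound: "\<And>s a. a \<in> pasts \<Longrightarrow> \<bar>f s a\<bar> \<le> C"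
  shows "((\<lambda>s. long_term_mean (P s) (f s)) \<longlongrightarrow> long_term_mean p f0) F"
proof -
  have le: "norm ((1 / real q) ^ i * (backward (P s) ^^ i) (f s) []) \<le> (1 / real q) ^ i * C" for i s
  proof -
    have "\<bar>(backward (P s) ^^ i) (f s) []\<bar> \<le> C"
      using bound by (intro transition_kernel.abs_iterate_back_le[OF kernel]) auto
    from mult_left_mono[OF this, of "(1 / real q) ^ i"] show ?thesis by (simp add: abs_mult)
  qed
  have "summable (\<lambda>i. (1 / real q) ^ i * C)"
    using q_ge_2 by (intro summable_mult2 summable_geometric) simp
  then have "((\<lambda>s. \<Sum>i. (1 / real q) ^ i * (backward (P s) ^^ i) (f s) [])
      \<longlongrightarrow> (\<Sum>i. (1 / real q) ^ i * (backward p ^^ i) f0 [])) F"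
    using tannerys_theorem[where a = "\<lambda>i s. (1 / real q) ^ i * (backward (P s) ^^ i) (f s) []"
        and b = "\<lambda>i. (1 / real q) ^ i * (backward p ^^ i) f0 []" and F = F and M = "\<lambda>i. (1 / real q) ^ i * C"]
      tendsto_iterate_backward[of P p F f f0 "[]", OF P f Nil_in_pasts] le F
    by (simp add: tendsto_mult always_eventually case_prod_unfold)
  then show ?thesis unfolding long_term_mean_def by (intro tendsto_mult tendsto_const)
qed

end

lemma abs_x_ln_x_le:
  fixes x :: real
  assumes "0 \<le> x" "x \<le> 1"
  shows "\<bar>x * ln x\<bar> \<le> 2 * sqrt x"
proof (cases "x = 0")
  case False
  then have x: "x > 0" using assms by simp
  have "- ln x = 2 * ln (1 / sqrt x)"
    using x by (simp add: ln_div ln_sqrt)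
  also have "\<dots> \<le> 2 * (1 / sqrt x)"
    using x ln_bound[of "1 / sqrt x"] by simp
  finally have "x * - ln x \<le> x * (2 * (1 / sqrt x))" using x by (intro mult_left_mono) auto
  also have "\<dots> = 2 * sqrt x" using x by (simp add: field_simps)
  finally have "x * - ln x \<le> 2 * sqrt x" .
  moreover have "x * ln x \<le> 0" using assms x by (intro mult_nonneg_nonpos) auto
  ultimately show ?thesis by simp
qed simp

lemma tendsto_x_ln_x:
  fixes f :: "'a \<Rightarrow> real"
  assumes f: "(f \<longlongrightarrow> c) F" and range: "\<And>s. 0 \<le> f s" "\<And>s. f s \<le> 1"
  shows "((\<lambda>s. f s * ln (f s)) \<longlongrightarrow> c * ln c) F"
proof (cases "c = 0")
  case False
  then show ?thesis by (intro tendsto_mult tendsto_ln f)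
next
  case True
  have "((\<lambda>s. 2 * sqrt (f s)) \<longlongrightarrow> 2 * sqrt 0) F"
    using f True by (intro tendsto_intros) auto
  then have "((\<lambda>s. 2 * sqrt (f s)) \<longlongrightarrow> 0) F" by simp
  then have "((\<lambda>s. f s * ln (f s)) \<longlongrightarrow> 0) F"
    by (rule Lim_null_comparison[rotated]) (auto simp: abs_x_ln_x_le range)
  with True show ?thesis by simp
qed

section \<open>The function psi and its kernel\<close>

lemma words_mem_iff: "w \<in> words m k \<longleftrightarrow> w \<in> lists {..<m} \<and> length w = k"
  by (auto simp: words_def)

context telescoping
begin

lemma shift_in_words: "a \<in> words m (l - 1) \<Longrightarrow> j < m \<Longrightarrow> tl a @ [j] \<in> words m (l - 1)"
  using l_ge_2 by (auto simp: words_def dest: list.set_sel(2)[rotated])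

lemma replicate_in_words: "replicate k 0 \<in> words m k"
  using m_ge_2 by (auto simp: words_def)

text \<open>Let \<open>R\<close> be the maximal ratio of \<open>f\<close> and \<open>g\<close>. The equations at a point where it is attained give
\<open>R\<^sup>q \<le> E R\<close>, hence \<open>R \<le> E\<close> as \<open>q \<ge> 2\<close>. The case \<open>E = 1\<close> yields uniqueness, and the general case yields
continuous dependence on the coefficients.\<close>

lemma fixed_point_comparison:
  assumes pos: "\<And>a. a \<in> words m (l - 1) \<Longrightarrow> 0 < f a" "\<And>a. a \<in> words m (l - 1) \<Longrightarrow> 0 < g a"
    and f: "\<And>a. a \<in> words m (l - 1) \<Longrightarrow> f a ^ q = (\<Sum>j<m. u a j * f (tl a @ [j]))"
    and g: "\<And>a. a \<in> words m (l - 1) \<Longrightarrow> g a ^ q = (\<Sum>j<m. v a j * g (tl a @ [j]))"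
    and u: "\<And>a j. 0 \<le> u a j" and uv: "\<And>a j. a \<in> words m (l - 1) \<Longrightarrow> j < m \<Longrightarrow> u a j \<le> E * v a j" and E: "E \<ge> 1"
    and a: "a \<in> words m (l - 1)"
  shows "f a \<le> E * (g a :: real)"
proof -
  let ?X = "words m (l - 1)"
  define R where "R = Max ((\<lambda>a. f a / g a) ` ?X)"
  have "R \<in> (\<lambda>a. f a / g a) ` ?X" unfolding R_def using a by (intro Max_in) auto
  then obtain b where b: "b \<in> ?X" "R = f b / g b" by auto
  have le: "f c \<le> R * g c" if "c \<in> ?X" for c
  proof -
    have "f c / g c \<le> R" unfolding R_def using that by (intro Max_ge) auto
    then show ?thesis using pos(2)[OF that] by (simp add: pos_divide_le_eq)
  qed
  have R: "R > 0" using pos[OF b(1)] b by simp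
  have "R \<le> E"
  proof (rule ccontr)
    assume "\<not> R \<le> E"
    then have "R > E" "R > 1" using E by auto
    have "f b ^ q \<le> (\<Sum>j<m. (E * v b j) * (R * g (tl b @ [j])))"
      unfolding f[OF b(1)]
    proof (intro sum_mono mult_mono)
      fix j assume "j \<in> {..<m}"
      then show "u b j \<le> E * v b j" "f (tl b @ [j]) \<le> R * g (tl b @ [j])" "0 \<le> f (tl b @ [j])" "0 \<le> E * v b j"
        using uv[OF b(1), of j] u[of b j] shift_in_words[OF b(1), of j] le pos(1) by (auto intro: less_imp_le order_trans)
    qed
    also have "\<dots> = E * R * g b ^ q"
      unfolding g[OF b(1)] by (simp add: sum_distrib_left mult_ac)
    finally have "R ^ q \<le> E * R"
      using pos(2)[OF b(1)] by (simp add: b(2) power_divide pos_divide_le_eq)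
    moreover have "R * R \<le> R ^ q"
      using power_increasing[OF q_ge_2, of R] \<open>R > 1\<close> by (simp add: power2_eq_square)
    ultimately have "R * R \<le> E * R" by simp
    with R \<open>R > E\<close> show False by simp
  qed
  with le[OF a] pos(2)[OF a] show ?thesis by (meson mult_right_mono less_imp_le order_trans)
qed

text \<open>Monotone iteration of the \<open>q\<close>-th root of the right-hand side, downwards from a constant
supersolution \<open>c\<close>; the constant subsolution \<open>k\<close> keeps the limit positive.\<close>

lemma fixed_point_exists:
  assumes u: "\<And>a j. a \<in> words m (l - 1) \<Longrightarrow> j < m \<Longrightarrow> 0 < (u a j :: real)"
  shows "\<exists>f. \<forall>a\<in>words m (l - 1). 0 < f a \<and> f a ^ q = (\<Sum>j<m. u a j * f (tl a @ [j]))"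
proof -
  let ?X = "words m (l - 1)"
  \<comment> \<open>The 1 is inserted so that \<open>k \<le> 1 \<le> K\<close>.\<close>
  define K where "K = Max (insert 1 ((\<lambda>(a, j). u a j) ` (?X \<times> {..<m})))"
  define k where "k = Min (insert 1 ((\<lambda>(a, j). u a j) ` (?X \<times> {..<m})))"
  have fin: "finite (insert 1 ((\<lambda>(a, j). u a j) ` (?X \<times> {..<m})))" by simp
  have K: "K \<ge> 1" "\<And>a j. a \<in> ?X \<Longrightarrow> j < m \<Longrightarrow> u a j \<le> K"
    unfolding K_def using fin by (auto intro!: Max_ge)
  have k: "0 < k" "k \<le> 1" "\<And>a j. a \<in> ?X \<Longrightarrow> j < m \<Longrightarrow> k \<le> u a j"
  proof -
    have "k \<in> insert 1 ((\<lambda>(a, j). u a j) ` (?X \<times> {..<m}))" unfolding k_def by (rule Min_in[OF fin]) simp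
    then show "0 < k" using u by auto
  qed (use fin in \<open>auto simp: k_def intro!: Min_le\<close>)
  define G where "G f a = root q (\<Sum>j<m. u a j * f (tl a @ [j]))" for f a
  have q: "q > 0" using q_ge_2 by simp
  have sum_nonneg: "0 \<le> (\<Sum>j<m. u a j * f (tl a @ [j]))" if "a \<in> ?X" "\<And>b. b \<in> ?X \<Longrightarrow> 0 \<le> f b" for f a
    using that u by (intro sum_nonneg mult_nonneg_nonneg) (auto intro: less_imp_le shift_in_words[unfolded One_nat_def])
  have G_mono: "G f a \<le> G g a" if "a \<in> ?X" "\<And>b. b \<in> ?X \<Longrightarrow> f b \<le> g b" for f g a
    unfolding G_def using that u q
    by (intro real_root_le_mono sum_mono mult_left_mono) (auto intro: less_imp_le shift_in_words[unfolded One_nat_def])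
  define c where "c = K * real m"
  have c: "c \<ge> 1" using K m_ge_2 mult_mono[of 1 K 1 "real m"] by (simp add: c_def)
  have top: "G (\<lambda>_. c) a \<le> c" if a: "a \<in> ?X" for a
  proof -
    have "(\<Sum>j<m. u a j * c) \<le> (\<Sum>j<m. K * c)"
      using K a c by (intro sum_mono mult_right_mono) auto
    also have "\<dots> = c ^ 2" by (simp add: c_def power2_eq_square)
    also have "\<dots> \<le> c ^ q" by (intro power_increasing q_ge_2 c)
    finally have "G (\<lambda>_. c) a \<le> root q (c ^ q)" unfolding G_def using q by (intro real_root_le_mono) auto
    then show ?thesis using q c by (simp add: real_root_power_cancel)
  qed
  have bot: "k \<le> G (\<lambda>_. k) a" if a: "a \<in> ?X" for a
  proof -
    have "k ^ q \<le> k ^ 2" using k by (intro power_decreasing q_ge_2) auto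
    also have "\<dots> \<le> (\<Sum>j<m. k * k)"
      using m_ge_2 k mult_right_mono[of 1 "real m" "k * k"] by (simp add: power2_eq_square)
    also have "\<dots> \<le> (\<Sum>j<m. u a j * k)"
      using k a by (intro sum_mono mult_right_mono) auto
    finally have "root q (k ^ q) \<le> G (\<lambda>_. k) a" unfolding G_def using q by (intro real_root_le_mono) auto
    then show ?thesis using q k by (simp add: real_root_power_cancel)
  qed
  define U where "U n = (G ^^ n) (\<lambda>_. c)" for n
  have U_Suc: "U (Suc n) = G (U n)" for n by (simp add: U_def)
  have lower: "k \<le> U n a" if "a \<in> ?X" for n a
    using that
  proof (induction n arbitrary: a)
    case 0
    then show ?case using k c by (simp add: U_def)
  next
    case (Suc n)
    have "k \<le> G (\<lambda>_. k) a" using Suc.prems by (rule bot)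
    also have "\<dots> \<le> G (U n) a" using Suc by (intro G_mono)
    finally show ?case by (simp add: U_Suc)
  qed
  have dec: "U (Suc n) a \<le> U n a" if "a \<in> ?X" for n a
    using that
  proof (induction n arbitrary: a)
    case 0
    then show ?case using top by (simp add: U_def)
  next
    case (Suc n)
    then show ?case unfolding U_Suc[of "Suc n"] by (subst U_Suc) (intro G_mono)
  qed
  have "\<exists>L. (\<lambda>n. U n a) \<longlonglongrightarrow> L" if a: "a \<in> ?X" for a
  proof -
    have "decseq (\<lambda>n. U n a)" using dec[OF a] by (intro decseq_SucI)
    then show ?thesis by (rule decseq_convergent) (use lower[OF a] in blast)+
  qed
  then obtain f where f: "\<And>a. a \<in> ?X \<Longrightarrow> (\<lambda>n. U n a) \<longlonglongrightarrow> f a" by metis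
  have "0 < f a \<and> f a ^ q = (\<Sum>j<m. u a j * f (tl a @ [j]))" if a: "a \<in> ?X" for a
  proof
    have "k \<le> f a" using f[OF a] lower[OF a] by (intro LIMSEQ_le_const) auto
    with k show "0 < f a" by simp
    have "(\<lambda>n. U (Suc n) a ^ q) \<longlonglongrightarrow> f a ^ q"
      using f[OF a] by (intro tendsto_power LIMSEQ_Suc)
    moreover have "U (Suc n) a ^ q = (\<Sum>j<m. u a j * U n (tl a @ [j]))" for n
    proof -
      have "0 \<le> U n b" if "b \<in> ?X" for b using lower[OF that, of n] k(1) by linarith
      then show ?thesis unfolding U_Suc G_def by (intro real_root_pow_pos2 q sum_nonneg a)
    qed
    ultimately have "(\<lambda>n. \<Sum>j<m. u a j * U n (tl a @ [j])) \<longlonglongrightarrow> f a ^ q" by simp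
    moreover have "(\<lambda>n. \<Sum>j<m. u a j * U n (tl a @ [j])) \<longlonglongrightarrow> (\<Sum>j<m. u a j * f (tl a @ [j]))"
      using a by (intro tendsto_sum tendsto_mult tendsto_const f shift_in_words) auto
    ultimately show "f a ^ q = (\<Sum>j<m. u a j * f (tl a @ [j]))" by (rule LIMSEQ_unique)
  qed
  then show ?thesis by blast
qed

end

locale multiple_average = telescoping +
  fixes \<phi> :: "nat list \<Rightarrow> real"
begin

abbreviation \<psi> :: "real \<Rightarrow> nat list \<Rightarrow> real" where
  "\<psi> s \<equiv> psi m l q \<phi> s"

lemma psi_base_fixed_point:
  assumes a: "a \<in> words m (l - 1)"
  shows "0 < psi_base m l q \<phi> s a"
    and "psi_base m l q \<phi> s a ^ q = (\<Sum>j<m. exp (s * \<phi> (a @ [j])) * psi_base m l q \<phi> s (tl a @ [j]))"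
proof -
  let ?X = "words m (l - 1)"
  let ?P = "\<lambda>f. f \<in> extensional ?X \<and> (\<forall>a\<in>?X. 0 < f a) \<and>
      (\<forall>a\<in>?X. f a ^ q = (\<Sum>j<m. exp (s * \<phi> (a @ [j])) * f (tl a @ [j])))"
  have "\<exists>!f. ?P f"
  proof (rule ex_ex1I)
    obtain f where f: "\<forall>a\<in>?X. 0 < f a \<and> f a ^ q = (\<Sum>j<m. exp (s * \<phi> (a @ [j])) * f (tl a @ [j]))"
      using fixed_point_exists[of "\<lambda>a j. exp (s * \<phi> (a @ [j]))"] by auto
    have "?P (restrict f ?X)"
      using f shift_in_words by (auto intro!: sum.cong)
    then show "\<exists>f. ?P f" by blast
  next
    fix f g assume f: "?P f" and g: "?P g"
    have "f b = g b" if b: "b \<in> ?X" for b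
    proof (rule antisym)
      show "f b \<le> g b"
        using fixed_point_comparison[of f g "\<lambda>a j. exp (s * \<phi> (a @ [j]))" "\<lambda>a j. exp (s * \<phi> (a @ [j]))" 1 b] f g b by simp
      show "g b \<le> f b"
        using fixed_point_comparison[of g f "\<lambda>a j. exp (s * \<phi> (a @ [j]))" "\<lambda>a j. exp (s * \<phi> (a @ [j]))" 1 b] f g b by simp
    qed
    then show "f = g" using f g by (intro extensionalityI[of f ?X g]) auto
  qed
  from theI'[OF this] have "?P (psi_base m l q \<phi> s)" unfolding psi_base_def .
  with a show "0 < psi_base m l q \<phi> s a"
    and "psi_base m l q \<phi> s a ^ q = (\<Sum>j<m. exp (s * \<phi> (a @ [j])) * psi_base m l q \<phi> s (tl a @ [j]))"
    by blast+
qed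

lemma psi_base_le:
  assumes a: "a \<in> words m (l - 1)" and \<Phi>: "\<And>w. w \<in> words m l \<Longrightarrow> \<bar>\<phi> w\<bar> \<le> \<Phi>"
  shows "psi_base m l q \<phi> s a \<le> exp (\<bar>s - t\<bar> * \<Phi>) * psi_base m l q \<phi> t a"
proof (rule fixed_point_comparison[where u = "\<lambda>a j. exp (s * \<phi> (a @ [j]))" and v = "\<lambda>a j. exp (t * \<phi> (a @ [j]))"])
  fix b j assume "b \<in> words m (l - 1)" "j < m"
  then have "b @ [j] \<in> words m l" using l_ge_2 by (auto simp: words_def)
  then have "\<bar>(s - t) * \<phi> (b @ [j])\<bar> \<le> \<bar>s - t\<bar> * \<Phi>"
    unfolding abs_mult by (intro mult_left_mono \<Phi>) auto
  then have "s * \<phi> (b @ [j]) \<le> \<bar>s - t\<bar> * \<Phi> + t * \<phi> (b @ [j])"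
    by (simp add: left_diff_distrib)
  then show "exp (s * \<phi> (b @ [j])) \<le> exp (\<bar>s - t\<bar> * \<Phi>) * exp (t * \<phi> (b @ [j]))"
    by (simp add: mult_exp_exp)
next
  have "\<Phi> \<ge> 0" using \<Phi>[OF replicate_in_words] by linarith
  then show "1 \<le> exp (\<bar>s - t\<bar> * \<Phi>)" by simp
qed (assumption | rule psi_base_fixed_point a | simp)+

lemma tendsto_psi_base:
  assumes a: "a \<in> words m (l - 1)"
  shows "((\<lambda>s. psi_base m l q \<phi> s a) \<longlongrightarrow> psi_base m l q \<phi> t a) (at t)"
proof -
  define \<Phi> where "\<Phi> = (\<Sum>w\<in>words m l. \<bar>\<phi> w\<bar>)"
  have \<Phi>: "\<bar>\<phi> w\<bar> \<le> \<Phi>" if "w \<in> words m l" for w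
    unfolding \<Phi>_def using that by (intro member_le_sum) auto
  show ?thesis
  proof (rule tendsto_sandwich)
    show "eventually (\<lambda>s. psi_base m l q \<phi> s a \<le> exp (\<bar>s - t\<bar> * \<Phi>) * psi_base m l q \<phi> t a) (at t)"
      by (intro always_eventually allI psi_base_le a \<Phi>)
    have "psi_base m l q \<phi> t a \<le> exp (\<bar>s - t\<bar> * \<Phi>) * psi_base m l q \<phi> s a" for s
      using psi_base_le[OF a \<Phi>, of t s] by (simp only: abs_minus_commute)
    then show "eventually (\<lambda>s. psi_base m l q \<phi> t a / exp (\<bar>s - t\<bar> * \<Phi>) \<le> psi_base m l q \<phi> s a) (at t)"
      by (intro always_eventually allI) (simp add: pos_divide_le_eq mult.commute)
    have "((\<lambda>s. exp (\<bar>s - t\<bar> * \<Phi>)) \<longlongrightarrow> exp (\<bar>t - t\<bar> * \<Phi>)) (at t)"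
      by (intro tendsto_intros)
    then have lim: "((\<lambda>s. exp (\<bar>s - t\<bar> * \<Phi>)) \<longlongrightarrow> 1) (at t)" by simp
    show "((\<lambda>s. exp (\<bar>s - t\<bar> * \<Phi>) * psi_base m l q \<phi> t a) \<longlongrightarrow> psi_base m l q \<phi> t a) (at t)"
      using tendsto_mult[OF lim tendsto_const[of "psi_base m l q \<phi> t a"]] by simp
    show "((\<lambda>s. psi_base m l q \<phi> t a / exp (\<bar>s - t\<bar> * \<Phi>)) \<longlongrightarrow> psi_base m l q \<phi> t a) (at t)"
      using tendsto_divide[OF tendsto_const[of "psi_base m l q \<phi> t a"] lim] by simp
  qed
qed

lemma psi_ext_pos: "d \<le> l - 1 \<Longrightarrow> a \<in> words m (l - 1 - d) \<Longrightarrow> 0 < psi_ext m l q \<phi> s d a"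
proof (induction d arbitrary: a)
  case 0
  then show ?case by (simp add: psi_base_fixed_point)
next
  case (Suc d)
  then have "a @ [j] \<in> words m (l - 1 - d)" if "j < m" for j
    using that by (auto simp: words_def)
  then have "0 < (\<Sum>j<m. psi_ext m l q \<phi> s d (a @ [j]))"
    using Suc m_ge_2 by (intro sum_pos) (auto simp: lessThan_empty_iff)
  then show ?case using q_ge_2 by simp
qed

lemma tendsto_psi_ext:
  "d \<le> l - 1 \<Longrightarrow> a \<in> words m (l - 1 - d) \<Longrightarrow>
     ((\<lambda>s. psi_ext m l q \<phi> s d a) \<longlongrightarrow> psi_ext m l q \<phi> t d a) (at t)"
proof (induction d arbitrary: a)
  case 0
  then show ?case by (simp add: tendsto_psi_base)
next
  case (Suc d)
  then have "a @ [j] \<in> words m (l - 1 - d)" if "j < m" for j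
    using that by (auto simp: words_def)
  then show ?case
    using Suc by (auto intro!: tendsto_real_root tendsto_sum)
qed

lemma psi_pos: "a \<in> pasts \<Longrightarrow> 0 < \<psi> s a"
  unfolding psi_def by (intro psi_ext_pos) (auto simp: pasts_def words_mem_iff)

lemma tendsto_psi: "a \<in> pasts \<Longrightarrow> ((\<lambda>s. \<psi> s a) \<longlongrightarrow> \<psi> t a) (at t)"
  unfolding psi_def by (intro tendsto_psi_ext) (auto simp: pasts_def words_mem_iff)

text \<open>With \<open>full_block\<close> and \<open>trunc\<close>, the fixed-point equation for words of length \<open>l - 1\<close> and the definition of
the extension to shorter words become one equation.\<close>

lemma psi_equation:
  assumes a: "a \<in> pasts"
  shows "\<psi> s a ^ q = (\<Sum>j<m. exp (s * full_block \<phi> (a @ [j])) * \<psi> s (trunc (a @ [j])))"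
proof (cases "length a = l - 1")
  case True
  then have "a \<in> words m (l - 1)" using a by (auto simp: pasts_def words_mem_iff)
  then have "\<psi> s a ^ q = (\<Sum>j<m. exp (s * \<phi> (a @ [j])) * psi_base m l q \<phi> s (tl a @ [j]))"
    using True by (simp add: psi_def psi_base_fixed_point(2))
  also have "\<dots> = (\<Sum>j<m. exp (s * full_block \<phi> (a @ [j])) * \<psi> s (trunc (a @ [j])))"
  proof -
    have "a \<noteq> []" using True l_ge_2 by auto
    then show ?thesis
      using True l_ge_2 by (intro sum.cong refl) (auto simp: full_block_def trunc_def psi_def tl_append2)
  qed
  finally show ?thesis .
next
  case False
  then have len: "length a < l - 1" using a l_ge_2 by (auto simp: pasts_def)
  define d where "d = l - 1 - Suc (length a)"
  have d: "l - 1 - length a = Suc d" using len by (simp add: d_def)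
  have pos: "0 < psi_ext m l q \<phi> s d (a @ [j])" if "j < m" for j
    using that len a by (intro psi_ext_pos) (auto simp: d_def pasts_def words_mem_iff)
  have "\<psi> s a ^ q = (\<Sum>j<m. psi_ext m l q \<phi> s d (a @ [j]))"
  proof -
    have "0 \<le> (\<Sum>j<m. psi_ext m l q \<phi> s d (a @ [j]))"
      using pos by (intro sum_nonneg less_imp_le) auto
    then show ?thesis unfolding psi_def d using q_ge_2 by simp
  qed
  also have "\<dots> = (\<Sum>j<m. exp (s * full_block \<phi> (a @ [j])) * \<psi> s (trunc (a @ [j])))"
    using len by (intro sum.cong refl) (auto simp: full_block_def trunc_def psi_def d_def)
  finally show ?thesis .
qed

lemma pressure_eq: "pressure m l q \<phi> s = real (q - 1) * real q ^ (l - 1) * ln (\<psi> s [])"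
proof -
  have "\<psi> s [] ^ q = (\<Sum>j<m. \<psi> s [j])"
    using psi_equation[OF Nil_in_pasts, of s] l_ge_2 by (simp add: full_block_def trunc_def)
  then have "pressure m l q \<phi> s = real (q - 1) * real q ^ (l - 2) * ln (\<psi> s [] ^ q)"
    by (simp add: pressure_def)
  also have "\<dots> = real (q - 1) * (real q ^ (l - 2) * real q) * ln (\<psi> s [])"
    using psi_pos[OF Nil_in_pasts] by (simp add: ln_realpow)
  also have "real q ^ (l - 2) * real q = real q ^ (l - 1)"
  proof -
    have "l - 1 = Suc (l - 2)" using l_ge_2 by simp
    then show ?thesis by simp
  qed
  finally show ?thesis .
qed

text \<open>The transition probabilities of the measure adapted to the parameter \<open>s\<close>.\<close>

definition gibbs_kernel :: "real \<Rightarrow> nat list \<Rightarrow> real" where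
  "gibbs_kernel s w = exp (s * full_block \<phi> w) * \<psi> s (trunc w) / \<psi> s (butlast w) ^ q"

lemma butlast_in_pasts: "w \<in> blocks \<Longrightarrow> butlast w \<in> pasts"
  using l_ge_2 by (auto simp: blocks_def pasts_def dest: in_set_butlastD)

lemma gibbs_kernel_pos: "w \<in> blocks \<Longrightarrow> 0 < gibbs_kernel s w"
  unfolding gibbs_kernel_def by (intro divide_pos_pos mult_pos_pos zero_less_power psi_pos) (auto simp: trunc_in_pasts butlast_in_pasts)

lemma transition_kernel_gibbs_kernel: "transition_kernel m l q (gibbs_kernel s)"
proof unfold_locales
  show "0 \<le> gibbs_kernel s w" if "w \<in> blocks" for w using gibbs_kernel_pos[OF that] by (rule less_imp_le)
  show "(\<Sum>j<m. gibbs_kernel s (a @ [j])) = 1" if "a \<in> pasts" for a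
  proof -
    have "(\<Sum>j<m. gibbs_kernel s (a @ [j])) = (\<Sum>j<m. exp (s * full_block \<phi> (a @ [j])) * \<psi> s (trunc (a @ [j]))) / \<psi> s a ^ q"
      by (simp add: gibbs_kernel_def sum_divide_distrib)
    also have "\<dots> = 1"
      unfolding psi_equation[OF that, symmetric] using psi_pos[OF that, of s] by simp
    finally show ?thesis .
  qed
qed

lemma tendsto_gibbs_kernel: "w \<in> blocks \<Longrightarrow> ((\<lambda>s. gibbs_kernel s w) \<longlongrightarrow> gibbs_kernel t w) (at t)"
  unfolding gibbs_kernel_def using psi_pos[OF butlast_in_pasts, of w t]
  by (intro tendsto_intros tendsto_psi) (auto simp: trunc_in_pasts butlast_in_pasts)

lemma ln_gibbs_kernel:
  assumes "w \<in> blocks"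
  shows "ln (gibbs_kernel s w) = s * full_block \<phi> w + ln (\<psi> s (trunc w)) - real q * ln (\<psi> s (butlast w))"
  using psi_pos[OF trunc_in_pasts[OF assms], of s] psi_pos[OF butlast_in_pasts[OF assms], of s]
  by (simp add: gibbs_kernel_def ln_mult ln_div ln_realpow)

definition mean_level :: "(nat list \<Rightarrow> real) \<Rightarrow> real" where
  "mean_level p = real q ^ (l - 1) * long_term_mean p (mean p (full_block \<phi>))"

text \<open>In \<open>- ln (gibbs_kernel s w)\<close> the two terms with \<open>\<psi>\<close> average to \<open>- backward (gibbs_kernel s) B + q B\<close> for \<open>B = ln \<psi>\<close>. Its
long-term mean telescopes by \<open>long_term_mean_step\<close>, leaving \<open>(q - 1) B []\<close>, which is \<open>P(s)/q\<^bsup>l-1\<^esup>\<close>.\<close>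

lemma entropy_gibbs_kernel:
  "long_term_mean (gibbs_kernel s) (mean (gibbs_kernel s) (\<lambda>w. - ln (gibbs_kernel s w))) = (pressure m l q \<phi> s - s * mean_level (gibbs_kernel s)) / real q ^ (l - 1)"
proof -
  interpret transition_kernel m l q "gibbs_kernel s" by (rule transition_kernel_gibbs_kernel)
  let ?B = "\<lambda>a. ln (\<psi> s a)"
  have "mean (gibbs_kernel s) (\<lambda>w. - ln (gibbs_kernel s w)) a
      = (- s) * mean (gibbs_kernel s) (full_block \<phi>) a + 1 * ((- 1) * backward (gibbs_kernel s) ?B a + real q * ?B a)" if a: "a \<in> pasts" for a
  proof -
    have "mean (gibbs_kernel s) (\<lambda>w. - ln (gibbs_kernel s w)) a
      = (\<Sum>j<m. (- s) * (gibbs_kernel s (a @ [j]) * full_block \<phi> (a @ [j])) - gibbs_kernel s (a @ [j]) * ?B (trunc (a @ [j])) + real q * ?B a * gibbs_kernel s (a @ [j]))"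
      unfolding mean_def using a by (intro sum.cong refl) (simp add: ln_gibbs_kernel snoc_in_blocks algebra_simps)
    also have "\<dots> = (- s) * mean (gibbs_kernel s) (full_block \<phi>) a - backward (gibbs_kernel s) ?B a + real q * ?B a * (\<Sum>j<m. gibbs_kernel s (a @ [j]))"
      by (simp add: sum.distrib sum_subtractf sum_distrib_left mean_def backward_def sum_negf)
    finally show ?thesis using a by (simp add: p_sum)
  qed
  then have "long_term_mean (gibbs_kernel s) (mean (gibbs_kernel s) (\<lambda>w. - ln (gibbs_kernel s w)))
      = long_term_mean (gibbs_kernel s) (\<lambda>a. (- s) * mean (gibbs_kernel s) (full_block \<phi>) a + 1 * ((- 1) * backward (gibbs_kernel s) ?B a + real q * ?B a))"
    by (rule long_term_mean_cong)
  also have "\<dots> = - s * long_term_mean (gibbs_kernel s) (mean (gibbs_kernel s) (full_block \<phi>)) - long_term_mean (gibbs_kernel s) (backward (gibbs_kernel s) ?B) + real q * long_term_mean (gibbs_kernel s) ?B"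
    unfolding long_term_mean_linear by simp
  also have "\<dots> = - s * long_term_mean (gibbs_kernel s) (mean (gibbs_kernel s) (full_block \<phi>)) + (real q - 1) * ?B []"
    unfolding long_term_mean_step[of ?B] using q_ge_2 by (simp add: field_simps)
  also have "\<dots> = (pressure m l q \<phi> s - s * mean_level (gibbs_kernel s)) / real q ^ (l - 1)"
    using q_ge_2 by (simp add: pressure_eq mean_level_def field_simps)
  finally show ?thesis .
qed

end

section \<open>The upper bound for level sets\<close>

lemma bounded_increment:
  fixes a :: "nat \<Rightarrow> real"
  assumes bound: "\<And>i. \<bar>a i\<bar> \<le> C" and e: "e > 0"
  shows "\<exists>i\<ge>N. a i - e \<le> a (Suc i)"
proof (rule ccontr)
  assume "\<not> ?thesis"
  then have step: "a (Suc i) < a i - e" if "i \<ge> N" for i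
    using that by (meson not_le)
  have "a (N + k) \<le> a N - real k * e" for k
  proof (induction k)
    case (Suc k)
    have "a (N + Suc k) \<le> a (N + k) - e" using step[of "N + k"] by simp
    with Suc show ?case by (simp add: algebra_simps)
  qed simp
  moreover obtain k where "2 * C < real k * e" using reals_Archimedean3[OF e] by blast
  ultimately have "a (N + k) < a N - 2 * C" by (smt (verit))
  with bound[of "N + k"] bound[of N] show False by linarith
qed

text \<open>Bolzano--Weierstrass for finitely many coordinates.\<close>

lemma finite_diagonal:
  fixes f :: "nat \<Rightarrow> 'a \<Rightarrow> real"
  assumes "finite A" "\<And>k a. a \<in> A \<Longrightarrow> \<bar>f k a\<bar> \<le> C"
  shows "\<exists>r p. strict_mono (r :: nat \<Rightarrow> nat) \<and> (\<forall>a\<in>A. (\<lambda>k. f (r k) a) \<longlonglongrightarrow> p a)"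
  using assms
proof (induction A rule: finite_induct)
  case empty
  show ?case by (intro exI[of _ id]) (auto simp: strict_mono_def)
next
  case (insert b A)
  then obtain r p where r: "strict_mono r" "\<And>a. a \<in> A \<Longrightarrow> (\<lambda>k. f (r k) a) \<longlonglongrightarrow> p a" by blast
  have "bounded (range (\<lambda>k. f (r k) b))"
    unfolding bounded_iff using insert.prems by (intro exI[of _ C]) auto
  then obtain z r' where r': "strict_mono r'" "((\<lambda>k. f (r k) b) \<circ> r') \<longlonglongrightarrow> z"
    using bounded_imp_convergent_subsequence by blast
  have "(\<lambda>k. f ((r \<circ> r') k) a) \<longlonglongrightarrow> (p(b := z)) a" if "a \<in> insert b A" for a
  proof (cases "a = b")
    case True
    with r'(2) show ?thesis by (simp add: o_def)
  next
    case False
    then have "(\<lambda>k. f (r k) a) \<longlonglongrightarrow> p a" using that r(2) by simp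
    from LIMSEQ_subseq_LIMSEQ[OF this r'(1)] False show ?thesis by (simp add: o_def)
  qed
  moreover have "strict_mono (r \<circ> r')" by (rule strict_mono_o[OF r(1) r'(1)])
  ultimately show ?case by blast
qed

context transition_kernel
begin

lemma p_le_1:
  assumes "w \<in> blocks" "w \<noteq> []"
  shows "p w \<le> 1"
proof -
  obtain a j where w: "w = a @ [j]" using assms(2) by (cases w rule: rev_cases) auto
  have a: "a \<in> pasts" and j: "j < m" using assms(1) w by (auto simp: blocks_def pasts_def)
  have "p (a @ [j]) \<le> (\<Sum>j<m. p (a @ [j]))"
    using j a by (intro member_le_sum) (auto simp: p_nonneg snoc_in_blocks)
  then show ?thesis using p_sum[OF a] w by simp
qed

lemma abs_entropy_le:
  assumes a: "a \<in> pasts"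
  shows "\<bar>mean p (\<lambda>w. - ln (p w)) a\<bar> \<le> 2 * real m"
proof -
  have "\<bar>mean p (\<lambda>w. - ln (p w)) a\<bar> \<le> (\<Sum>j<m. \<bar>p (a @ [j]) * - ln (p (a @ [j]))\<bar>)"
    unfolding mean_def by (rule sum_abs)
  also have "\<dots> \<le> (\<Sum>j<m. 2)"
  proof (intro sum_mono)
    fix j assume "j \<in> {..<m}"
    then have "a @ [j] \<in> blocks" using a by (simp add: snoc_in_blocks)
    then have "0 \<le> p (a @ [j])" "p (a @ [j]) \<le> 1" by (auto intro: p_nonneg p_le_1)
    then have "\<bar>p (a @ [j]) * ln (p (a @ [j]))\<bar> \<le> 2 * sqrt (p (a @ [j]))" "sqrt (p (a @ [j])) \<le> 1"
      by (auto intro: abs_x_ln_x_le)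
    then show "\<bar>p (a @ [j]) * - ln (p (a @ [j]))\<bar> \<le> 2"
      unfolding mult_minus_right abs_minus_cancel by linarith
  qed
  also have "\<dots> = 2 * real m" by simp
  finally show ?thesis .
qed

end

context multiple_average
begin

abbreviation P :: "real \<Rightarrow> real" where
  "P \<equiv> pressure m l q \<phi>"

text \<open>In the logarithm of the weight of the first \<open>n = q\<^bsup>i+1\<^esup>\<close> letters, the terms with \<open>\<psi>\<close> contribute
\<open>n (a (i + 1) - a i)\<close> for the bounded sequence \<open>a i = S (q\<^sup>i) / q\<^sup>i\<close>, besides the constant giving the pressure.\<close>

lemma heavy_prefixes:
  assumes x: "x \<in> level_set m l q \<phi> \<alpha>" and e: "e > 0"
  shows "\<exists>n\<ge>max 1 N. exp (- (real n * ((P s - s * \<alpha>) / real q ^ (l - 1) + e)))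
      \<le> transition_kernel.chain_weight l q (gibbs_kernel s) (seq_prefix x n)"
proof -
  interpret transition_kernel m l q "gibbs_kernel s" by (rule transition_kernel_gibbs_kernel)
  define h where "h = l - 1"
  define b where "b = ln (\<psi> s [])"
  define B where "B k = ln (\<psi> s (trunc (window x k)))" for k
  define S where "S n = (\<Sum>k=1..n. B k)" for n
  define T where "T n = (\<Sum>k=1..n. \<phi> (map (\<lambda>i. x (k * q ^ i)) [0..<l]))" for n
  define a where "a i = S (q ^ i) / real (q ^ i)" for i
  have x_space: "x \<in> seq_space m" and T_lim: "(\<lambda>n. T n / real n) \<longlonglongrightarrow> \<alpha>"
    using x by (auto simp: level_set_def T_def)
  have q: "q > 0" "real q > 0" using q_ge_2 by auto
  obtain C where C: "C > 0" "\<And>w. w \<in> blocks \<Longrightarrow> \<bar>ln (\<psi> s (trunc w))\<bar> \<le> C"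
    using bounded_on_blocks[of "\<lambda>w. ln (\<psi> s (trunc w))"] by blast
  have a_bound: "\<bar>a i\<bar> \<le> C" for i
  proof -
    have "\<bar>S (q ^ i)\<bar> \<le> (\<Sum>k=1..q ^ i. C)"
      unfolding S_def B_def
      by (intro order_trans[OF sum_abs] sum_mono C window_in_blocks x_space) auto
    then show ?thesis using q by (simp add: a_def abs_divide field_simps)
  qed
  have log_weight: "ln (chain_weight (seq_prefix x n)) = s * T (n div q ^ h) + S n - real q * (real (n - n div q) * b + S (n div q))" for n
  proof -
    have blocks: "window x k \<in> blocks" if "k \<in> {1..n}" for k
      using that by (intro window_in_blocks x_space) auto
    have butlast: "butlast (window x k) = past x k" for k by (simp add: window_eq[of x k])
    have nonzero: "gibbs_kernel s (window x k) \<noteq> 0" if "k \<in> {1..n}" for k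
      using gibbs_kernel_pos[OF blocks[OF that], of s] by simp
    have "ln (chain_weight (seq_prefix x n)) = (\<Sum>k=1..n. ln (gibbs_kernel s (window x k)))"
      unfolding chain_weight_prefix by (intro ln_prod finite_atLeastAtMost nonzero)
    also have "\<dots> = (\<Sum>k=1..n. s * full_block \<phi> (window x k) + B k - real q * ln (\<psi> s (past x k)))"
      using blocks by (intro sum.cong refl) (simp add: ln_gibbs_kernel B_def butlast)
    also have "\<dots> = s * (\<Sum>k=1..n. full_block \<phi> (window x k)) + S n - real q * (\<Sum>k=1..n. ln (\<psi> s (past x k)))"
      by (simp add: sum.distrib sum_subtractf sum_distrib_left S_def)
    finally show ?thesis
      unfolding sum_full_window sum_past[where f = "\<lambda>a. ln (\<psi> s a)"] T_def[symmetric] S_def B_def b_def h_def .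
  qed
  have "(\<lambda>i. T (q ^ i) / real (q ^ i)) \<longlonglongrightarrow> \<alpha>"
  proof -
    have "filterlim (\<lambda>i. q ^ i) at_top sequentially"
      using q_ge_2 by (intro filterlim_subseq) (auto simp: strict_mono_def)
    from filterlim_compose[OF T_lim this] show ?thesis .
  qed
  then have "(\<lambda>i. s * (T (q ^ i) / real (q ^ i)) / real q ^ h) \<longlonglongrightarrow> s * \<alpha> / real q ^ h"
    using q by (intro tendsto_intros) auto
  then have "eventually (\<lambda>i. s * \<alpha> / real q ^ h - e / 2 < s * (T (q ^ i) / real (q ^ i)) / real q ^ h) sequentially"
    using e by (intro order_tendstoD) auto
  then obtain I where I: "\<And>i. i \<ge> I \<Longrightarrow> s * \<alpha> / real q ^ h - e / 2 < s * (T (q ^ i) / real (q ^ i)) / real q ^ h"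
    by (auto simp: eventually_sequentially)
  obtain i where i: "i \<ge> I + h + N" "a i - e / 2 \<le> a (Suc i)"
    using bounded_increment[of a C "e / 2" "I + h + N"] a_bound e by auto
  define n where "n = q ^ Suc i"
  have n: "real n > 0" using q by (simp add: n_def)
  have "Suc i < q ^ Suc i" using q_ge_2 by (intro power_gt_expt) auto
  then have n_ge: "n \<ge> max 1 N" using i unfolding n_def by linarith
  have div1: "n div q = q ^ i" using q by (simp add: n_def)
  define i' where "i' = Suc i - h"
  have split: "n = q ^ i' * q ^ h" using i by (simp add: n_def i'_def power_add[symmetric] del: power_Suc)
  have divh: "n div q ^ h = q ^ i'" unfolding split using q by simp
  have n1: "real n = real q * real (q ^ i)" and n2: "real n = real (q ^ i') * real q ^ h"
    using split by (simp_all add: n_def flip: of_nat_mult of_nat_power)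
  have 1: "real n * (s * \<alpha> / real q ^ h - e / 2) \<le> s * T (n div q ^ h)"
  proof -
    have "real n * (s * \<alpha> / real q ^ h - e / 2) \<le> real n * (s * (T (q ^ i') / real (q ^ i')) / real q ^ h)"
    proof (intro mult_left_mono)
      have "i' \<ge> I" using i(1) unfolding i'_def by linarith
      then show "s * \<alpha> / real q ^ h - e / 2 \<le> s * (T (q ^ i') / real (q ^ i')) / real q ^ h"
        using I by (simp add: less_imp_le)
    qed (use n in simp)
    also have "\<dots> = s * T (n div q ^ h)" unfolding divh n2 using q by simp
    finally show ?thesis .
  qed
  have 2: "- (real n * (e / 2)) \<le> S n - real q * S (n div q)"
  proof -
    have "S n - real q * S (n div q) = real n * (a (Suc i) - a i)"
      unfolding div1 a_def n_def[symmetric] using q n by (simp add: n1 field_simps)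
    moreover have "real n * (- (e / 2)) \<le> real n * (a (Suc i) - a i)"
      using i n by (intro mult_left_mono) auto
    ultimately show ?thesis by simp
  qed
  have 3: "real q * (real (n - n div q) * b) = real n * (real (q - 1) * b)"
  proof -
    have "n - n div q = q ^ i * (q - 1)" unfolding div1 by (simp add: n_def algebra_simps diff_mult_distrib2)
    then show ?thesis by (simp add: n1)
  qed
  have rate: "(P s - s * \<alpha>) / real q ^ (l - 1) = real (q - 1) * b - s * \<alpha> / real q ^ h"
    using q by (simp add: pressure_eq b_def h_def field_simps)
  have "- (real n * ((P s - s * \<alpha>) / real q ^ (l - 1) + e))
      = real n * (s * \<alpha> / real q ^ h - e / 2) - real n * (e / 2) - real n * (real (q - 1) * b)"
    unfolding rate by (simp add: algebra_simps)
  also have "\<dots> \<le> ln (chain_weight (seq_prefix x n))"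
    unfolding log_weight distrib_left[of "real q"] 3 using 1 2 by linarith
  finally have "exp (- (real n * ((P s - s * \<alpha>) / real q ^ (l - 1) + e))) \<le> exp (ln (chain_weight (seq_prefix x n)))"
    by simp
  moreover have "0 < chain_weight (seq_prefix x n)"
    unfolding chain_weight_prefix using x_space by (intro prod_pos ballI gibbs_kernel_pos window_in_blocks) auto
  ultimately show ?thesis using n_ge by auto
qed

text \<open>Otherwise \<open>heavy_prefixes\<close> would produce a cylinder of weight greater than 1.\<close>

lemma pressure_minus_nonneg:
  assumes x: "x \<in> level_set m l q \<phi> \<alpha>"
  shows "0 \<le> P s - s * \<alpha>"
proof (rule ccontr)
  interpret transition_kernel m l q "gibbs_kernel s" by (rule transition_kernel_gibbs_kernel)
  define D where "D = (P s - s * \<alpha>) / real q ^ (l - 1)"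
  assume "\<not> 0 \<le> P s - s * \<alpha>"
  then have D: "D < 0" using q_ge_2 by (simp add: D_def divide_less_0_iff)
  obtain n where n: "n \<ge> 1" "exp (- (real n * (D + - D / 2))) \<le> chain_weight (seq_prefix x n)"
    using heavy_prefixes[OF x, of "- D / 2" 1 s] D unfolding D_def[symmetric] by auto
  have "x \<in> seq_space m" using x by (simp add: level_set_def)
  then have mem: "seq_prefix x n \<in> words m n" by (rule seq_prefix_in_words)
  have "chain_weight (seq_prefix x n) \<le> (\<Sum>w\<in>words m n. chain_weight w)"
    using mem by (intro member_le_sum finite_words) (auto intro!: weight_nonneg simp: words_mem_iff)
  also have "\<dots> = 1" by (rule sum_weight_words)
  finally have "exp (- (real n * (D + - D / 2))) \<le> 1" using n(2) by linarith
  moreover have "0 < real n * (- D)" using n(1) D by (intro mult_pos_pos) auto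
  ultimately show False by (simp add: field_simps)
qed

lemma level_set_dim_le:
  assumes x: "level_set m l q \<phi> \<alpha> \<noteq> {}"
  shows "hausdorff_dim (seq_space m) (seq_dist m) (level_set m l q \<phi> \<alpha>) \<le> ereal ((P s - s * \<alpha>) / (real q ^ (l - 1) * ln (real m)))"
proof -
  interpret transition_kernel m l q "gibbs_kernel s" by (rule transition_kernel_gibbs_kernel)
  define D where "D = (P s - s * \<alpha>) / real q ^ (l - 1)"
  have "hausdorff_dim (seq_space m) (seq_dist m) (level_set m l q \<phi> \<alpha>) \<le> ereal (D / ln (real m))"
  proof (rule hausdorff_dim_le_local_dim[OF m_ge_2, where \<mu> = chain_weight])
    show "level_set m l q \<phi> \<alpha> \<subseteq> seq_space m" by (auto simp: level_set_def)
    show "0 \<le> D" using x pressure_minus_nonneg by (auto simp: D_def)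
    show "(\<Sum>w\<in>words m n. chain_weight w) \<le> 1" for n by (simp add: sum_weight_words)
    show "\<exists>n\<ge>N. exp (- (real n * (D + e))) \<le> chain_weight (seq_prefix x n)"
      if "x \<in> level_set m l q \<phi> \<alpha>" "e > 0" for x e N
      using heavy_prefixes[OF that, of N s] unfolding D_def by auto
  qed (rule weight_nonneg)
  then show ?thesis by (simp add: D_def)
qed

section \<open>The derivative of the pressure and the spectrum\<close>

definition pressure_slope :: "real \<Rightarrow> real" where
  "pressure_slope s = mean_level (gibbs_kernel s)"

lemma level_set_pressure_slope:
  shows "level_set m l q \<phi> (pressure_slope s) \<noteq> {}"
    and "ereal ((P s - s * pressure_slope s) / (real q ^ (l - 1) * ln (real m)))
      \<le> hausdorff_dim (seq_space m) (seq_dist m) (level_set m l q \<phi> (pressure_slope s))"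
  using transition_kernel.level_set_of_kernel[OF transition_kernel_gibbs_kernel[of s], of \<phi>,
      folded mean_level_def, folded pressure_slope_def, unfolded entropy_gibbs_kernel]
  by (simp_all add: pressure_slope_def)

text \<open>The dimension of the level set of \<open>pressure_slope s\<close> is at least the value for \<open>s\<close> and at most the
value for \<open>t\<close>.\<close>

lemma pressure_slope_subgradient: "P s + (t - s) * pressure_slope s \<le> P t"
proof -
  have "ereal ((P s - s * pressure_slope s) / (real q ^ (l - 1) * ln (real m)))
      \<le> ereal ((P t - t * pressure_slope s) / (real q ^ (l - 1) * ln (real m)))"
    by (rule order_trans[OF level_set_pressure_slope(2) level_set_dim_le[OF level_set_pressure_slope(1)]])
  moreover have "real q ^ (l - 1) * ln (real m) > 0" using q_ge_2 m_ge_2 by simp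
  ultimately have "P s - s * pressure_slope s \<le> P t - t * pressure_slope s"
    by (simp only: ereal_less_eq divide_le_cancel)
  then show ?thesis by (simp add: algebra_simps)
qed

lemma pressure_slope_mono: "s \<le> t \<Longrightarrow> pressure_slope s \<le> pressure_slope t"
proof (cases "s = t")
  case False
  assume "s \<le> t"
  then have "s < t" using False by simp
  have "(t - s) * pressure_slope s \<le> (t - s) * pressure_slope t"
    using pressure_slope_subgradient[of s t] pressure_slope_subgradient[of t s] by (simp add: algebra_simps)
  with \<open>s < t\<close> show ?thesis by simp
qed simp

lemma tendsto_pressure_slope: "(pressure_slope \<longlongrightarrow> pressure_slope t) (at t)"
proof -
  obtain C where C: "C > 0" "\<And>w. w \<in> blocks \<Longrightarrow> \<bar>full_block \<phi> w\<bar> \<le> C" using bounded_on_blocks by blast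
  have "((\<lambda>s. long_term_mean (gibbs_kernel s) (mean (gibbs_kernel s) (full_block \<phi>))) \<longlongrightarrow> long_term_mean (gibbs_kernel t) (mean (gibbs_kernel t) (full_block \<phi>))) (at t)"
  proof (rule tendsto_long_term_mean[OF _ transition_kernel_gibbs_kernel])
    show "((\<lambda>s. mean (gibbs_kernel s) (full_block \<phi>) a) \<longlongrightarrow> mean (gibbs_kernel t) (full_block \<phi>) a) (at t)" if "a \<in> pasts" for a
      unfolding mean_def using that by (intro tendsto_intros tendsto_gibbs_kernel) (auto simp: snoc_in_blocks)
    show "\<bar>mean (gibbs_kernel s) (full_block \<phi>) a\<bar> \<le> C" if "a \<in> pasts" for s a
      using that by (intro transition_kernel.abs_mean_le[OF transition_kernel_gibbs_kernel] C) (auto simp: snoc_in_blocks)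
  qed (auto intro: tendsto_gibbs_kernel)
  then show ?thesis unfolding pressure_slope_def mean_level_def by (intro tendsto_mult tendsto_const)
qed

text \<open>The subgradient inequalities at \<open>s\<close> and at \<open>t\<close> enclose the difference quotient between the slopes at
these two points, and the slope is continuous.\<close>

lemma has_derivative_pressure: "(P has_real_derivative pressure_slope t) (at t)"
  unfolding has_field_derivative_iff
proof (rule LIM_zero_cancel)
  show "((\<lambda>s. (P s - P t) / (s - t) - pressure_slope t) \<longlongrightarrow> 0) (at t)"
  proof (rule Lim_null_comparison)
    show "((\<lambda>s. \<bar>pressure_slope s - pressure_slope t\<bar>) \<longlongrightarrow> 0) (at t)"
      using tendsto_rabs[OF LIM_zero[OF tendsto_pressure_slope[of t]]] by simp
    have "\<bar>(P s - P t) / (s - t) - pressure_slope t\<bar> \<le> \<bar>pressure_slope s - pressure_slope t\<bar>" if "s \<noteq> t" for s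
    proof -
      have bounds: "0 \<le> P s - P t - (s - t) * pressure_slope t"
          "P s - P t - (s - t) * pressure_slope t \<le> (s - t) * (pressure_slope s - pressure_slope t)"
        using pressure_slope_subgradient[of t s] pressure_slope_subgradient[of s t] by (simp_all add: algebra_simps)
      then have "\<bar>P s - P t - (s - t) * pressure_slope t\<bar> \<le> \<bar>s - t\<bar> * \<bar>pressure_slope s - pressure_slope t\<bar>"
        unfolding abs_mult[symmetric] by linarith
      moreover have "(P s - P t) / (s - t) - pressure_slope t = (P s - P t - (s - t) * pressure_slope t) / (s - t)"
        using that by (simp add: diff_divide_distrib)
      ultimately show ?thesis
        using that by (simp add: abs_divide pos_divide_le_eq mult.commute)
    qed
    then show "eventually (\<lambda>s. norm ((P s - P t) / (s - t) - pressure_slope t) \<le> \<bar>pressure_slope s - pressure_slope t\<bar>) (at t)"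
      by (auto simp: eventually_at_filter)
  qed
qed

lemma deriv_pressure: "deriv P = pressure_slope"
  by (intro ext DERIV_imp_deriv has_derivative_pressure)

lemma bounded_pressure_slope: "\<exists>C. \<forall>s. \<bar>pressure_slope s\<bar> \<le> C"
proof -
  obtain C where C: "C > 0" "\<And>w. w \<in> blocks \<Longrightarrow> \<bar>full_block \<phi> w\<bar> \<le> C" using bounded_on_blocks by blast
  have "\<bar>pressure_slope s\<bar> \<le> real q ^ (l - 1) * C" for s
  proof -
    interpret transition_kernel m l q "gibbs_kernel s" by (rule transition_kernel_gibbs_kernel)
    have "\<bar>long_term_mean (gibbs_kernel s) (mean (gibbs_kernel s) (full_block \<phi>))\<bar> \<le> C"
      by (intro abs_long_term_mean_le abs_mean_le C) (auto simp: snoc_in_blocks)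
    then show ?thesis by (simp add: pressure_slope_def mean_level_def abs_mult mult_left_mono)
  qed
  then show ?thesis by blast
qed

lemma tendsto_pressure_slope_infinity:
  shows "(pressure_slope \<longlongrightarrow> (SUP s. pressure_slope s)) at_top"
    and "(pressure_slope \<longlongrightarrow> (INF s. pressure_slope s)) at_bot"
    and "pressure_slope s \<le> (SUP s. pressure_slope s)" "(INF s. pressure_slope s) \<le> pressure_slope s"
proof -
  obtain C where C: "\<And>s. \<bar>pressure_slope s\<bar> \<le> C" using bounded_pressure_slope by blast
  have bdd: "bdd_above (range pressure_slope)" "bdd_below (range pressure_slope)"
    using C by (auto intro!: bdd_aboveI[of _ C] bdd_belowI[of _ "- C"] simp: abs_le_iff minus_le_iff)
  show upper: "pressure_slope s \<le> (SUP s. pressure_slope s)" and lower: "(INF s. pressure_slope s) \<le> pressure_slope s" for s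
    using bdd by (auto intro: cSUP_upper cINF_lower)
  show "(pressure_slope \<longlongrightarrow> (SUP s. pressure_slope s)) at_top"
  proof (rule increasing_tendsto)
    fix y assume "y < (SUP s. pressure_slope s)"
    then obtain s where "y < pressure_slope s" using less_cSUP_iff[OF _ bdd(1)] by auto
    then have "y < pressure_slope t" if "t \<ge> s" for t using pressure_slope_mono[OF that] by simp
    then show "eventually (\<lambda>t. y < pressure_slope t) at_top"
      by (auto simp: eventually_at_top_linorder)
  qed (simp add: upper)
  show "(pressure_slope \<longlongrightarrow> (INF s. pressure_slope s)) at_bot"
  proof (rule decreasing_tendsto)
    fix y assume "(INF s. pressure_slope s) < y"
    then obtain s where "pressure_slope s < y" using cINF_less_iff[OF _ bdd(2)] by auto
    then have "pressure_slope t < y" if "t \<le> s" for t using pressure_slope_mono[OF that] by simp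
    then show "eventually (\<lambda>t. pressure_slope t < y) at_bot"
      by (auto simp: eventually_at_bot_linorder)
  qed (simp add: lower)
qed

lemma pressure_deriv_eq:
  shows "pressure_deriv m l q \<phi> (ereal s) = pressure_slope s"
    and "pressure_deriv m l q \<phi> \<infinity> = (SUP s. pressure_slope s)"
    and "pressure_deriv m l q \<phi> (-\<infinity>) = (INF s. pressure_slope s)"
  using tendsto_Lim[OF _ tendsto_pressure_slope_infinity(1)] tendsto_Lim[OF _ tendsto_pressure_slope_infinity(2)]
  by (simp_all add: pressure_deriv_def deriv_pressure)

text \<open>Covers finite parameters, by a constant sequence \<open>s\<close>, and both infinite ones. A subsequence of the
kernels converges to a kernel, whose mean of \<open>\<phi>\<close> is \<open>\<alpha>\<close>. The sign condition, a consequence of the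
monotonicity of the slope, makes \<open>P(s\<^sub>k) - s\<^sub>k \<alpha>\<close> a lower bound for the value
\<open>P(s\<^sub>k) - s\<^sub>k pressure_slope(s\<^sub>k)\<close> that determines the entropy.\<close>

lemma level_set_limit_slope:
  assumes lim: "(\<lambda>k. pressure_slope (s k)) \<longlonglongrightarrow> \<alpha>"
    and sign: "\<And>k. 0 \<le> s k * (\<alpha> - pressure_slope (s k))"
  shows "level_set m l q \<phi> \<alpha> \<noteq> {}"
    and "(\<And>s. D \<le> P s - s * \<alpha>) \<Longrightarrow> ereal (D / (real q ^ (l - 1) * ln (real m)))
      \<le> hausdorff_dim (seq_space m) (seq_dist m) (level_set m l q \<phi> \<alpha>)"
proof -
  have range: "0 \<le> gibbs_kernel t w" "gibbs_kernel t w \<le> 1" if "w \<in> blocks - {[]}" for t w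
    using that gibbs_kernel_pos[of w t] transition_kernel.p_le_1[OF transition_kernel_gibbs_kernel, of w t] by auto
  obtain r p where r: "strict_mono r" and p: "\<And>w. w \<in> blocks - {[]} \<Longrightarrow> (\<lambda>k. gibbs_kernel (s (r k)) w) \<longlonglongrightarrow> p w"
    using finite_diagonal[of "blocks - {[]}" "\<lambda>k. gibbs_kernel (s k)" 1] range by fastforce
  \<comment> \<open>The subsequence says nothing about the empty word, where a kernel only has to be nonnegative.\<close>
  define p0 where "p0 = p([] := 0)"
  have p0: "(\<lambda>k. gibbs_kernel (s (r k)) w) \<longlonglongrightarrow> p0 w" if "w \<in> blocks" "w \<noteq> []" for w
    using p that by (simp add: p0_def)
  have kernel: "transition_kernel m l q p0"
  proof unfold_locales
    show "0 \<le> p0 w" if "w \<in> blocks" for w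
    proof (cases "w = []")
      case False
      then show ?thesis using range that by (intro LIMSEQ_le_const[OF p0]) auto
    qed (simp add: p0_def)
    show "(\<Sum>j<m. p0 (a @ [j])) = 1" if a: "a \<in> pasts" for a
    proof (rule LIMSEQ_unique)
      show "(\<lambda>k. \<Sum>j<m. gibbs_kernel (s (r k)) (a @ [j])) \<longlonglongrightarrow> (\<Sum>j<m. p0 (a @ [j]))"
        using a by (intro tendsto_sum p0) (auto simp: snoc_in_blocks)
      show "(\<lambda>k. \<Sum>j<m. gibbs_kernel (s (r k)) (a @ [j])) \<longlonglongrightarrow> 1"
        using transition_kernel.p_sum[OF transition_kernel_gibbs_kernel a] by simp
    qed
  qed
  obtain C where C: "C > 0" "\<And>w. w \<in> blocks \<Longrightarrow> \<bar>full_block \<phi> w\<bar> \<le> C" using bounded_on_blocks by blast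
  have "(\<lambda>k. long_term_mean (gibbs_kernel (s (r k))) (mean (gibbs_kernel (s (r k))) (full_block \<phi>))) \<longlonglongrightarrow> long_term_mean p0 (mean p0 (full_block \<phi>))"
  proof (rule tendsto_long_term_mean[OF _ transition_kernel_gibbs_kernel p0])
    show "(\<lambda>k. mean (gibbs_kernel (s (r k))) (full_block \<phi>) a) \<longlonglongrightarrow> mean p0 (full_block \<phi>) a" if "a \<in> pasts" for a
      unfolding mean_def using that by (intro tendsto_intros p0) (auto simp: snoc_in_blocks)
    show "\<bar>mean (gibbs_kernel (s (r k))) (full_block \<phi>) a\<bar> \<le> C" if "a \<in> pasts" for k a
      using that by (intro transition_kernel.abs_mean_le[OF transition_kernel_gibbs_kernel] C) (auto simp: snoc_in_blocks)
  qed auto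
  then have "(\<lambda>k. pressure_slope (s (r k))) \<longlonglongrightarrow> real q ^ (l - 1) * long_term_mean p0 (mean p0 (full_block \<phi>))"
    unfolding pressure_slope_def mean_level_def by (intro tendsto_mult tendsto_const)
  moreover have "(\<lambda>k. pressure_slope (s (r k))) \<longlonglongrightarrow> \<alpha>"
    using LIMSEQ_subseq_LIMSEQ[OF lim r] by (simp add: o_def)
  ultimately have \<alpha>: "real q ^ (l - 1) * long_term_mean p0 (mean p0 (full_block \<phi>)) = \<alpha>" by (rule LIMSEQ_unique)
  note level = transition_kernel.level_set_of_kernel[OF kernel, of \<phi>, unfolded \<alpha>]
  show "level_set m l q \<phi> \<alpha> \<noteq> {}" by (rule level(1))
  assume D: "\<And>s. D \<le> P s - s * \<alpha>"
  let ?H = "\<lambda>p. long_term_mean p (mean p (\<lambda>w. - ln (p w)))"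
  have "(\<lambda>k. ?H (gibbs_kernel (s (r k)))) \<longlonglongrightarrow> ?H p0"
  proof (rule tendsto_long_term_mean[OF _ transition_kernel_gibbs_kernel p0])
    show "(\<lambda>k. mean (gibbs_kernel (s (r k))) (\<lambda>w. - ln (gibbs_kernel (s (r k)) w)) a) \<longlonglongrightarrow> mean p0 (\<lambda>w. - ln (p0 w)) a"
      if a: "a \<in> pasts" for a
      unfolding mean_def mult_minus_right using a range
      by (intro tendsto_sum tendsto_minus tendsto_x_ln_x p0) (auto simp: snoc_in_blocks)
    show "\<bar>mean (gibbs_kernel (s (r k))) (\<lambda>w. - ln (gibbs_kernel (s (r k)) w)) a\<bar> \<le> 2 * real m" if "a \<in> pasts" for k a
      by (rule transition_kernel.abs_entropy_le[OF transition_kernel_gibbs_kernel that])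
  qed auto
  moreover have "D / real q ^ (l - 1) \<le> ?H (gibbs_kernel t)" if "0 \<le> t * (\<alpha> - pressure_slope t)" for t
  proof -
    have "D \<le> P t - t * pressure_slope t" using D[of t] that by (simp add: algebra_simps)
    then show ?thesis unfolding entropy_gibbs_kernel pressure_slope_def by (intro divide_right_mono) auto
  qed
  ultimately have "D / real q ^ (l - 1) \<le> ?H p0"
    using sign by (intro LIMSEQ_le_const) auto
  then have "D / real q ^ (l - 1) / ln (real m) \<le> ?H p0 / ln (real m)"
    using m_ge_2 by (intro divide_right_mono) auto
  then have "ereal (D / (real q ^ (l - 1) * ln (real m))) \<le> ereal (?H p0 / ln (real m))" by simp
  also note level(2)
  finally show "ereal (D / (real q ^ (l - 1) * ln (real m)))
      \<le> hausdorff_dim (seq_space m) (seq_dist m) (level_set m l q \<phi> \<alpha>)" .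
qed

lemma pressure_deriv_sequence:
  assumes "\<alpha> = pressure_deriv m l q \<phi> t"
  shows "\<exists>s. (\<lambda>k. pressure_slope (s k)) \<longlonglongrightarrow> \<alpha> \<and> (\<forall>k::nat. 0 \<le> s k * (\<alpha> - pressure_slope (s k)))"
proof (cases t)
  case (real r)
  then show ?thesis using assms by (intro exI[of _ "\<lambda>_. r"]) (simp add: pressure_deriv_eq)
next
  case PInf
  have "(\<lambda>k. pressure_slope (real k)) \<longlonglongrightarrow> \<alpha>"
    using filterlim_compose[OF tendsto_pressure_slope_infinity(1) filterlim_real_sequentially] assms PInf
    by (simp add: pressure_deriv_eq)
  moreover have "0 \<le> real k * (\<alpha> - pressure_slope (real k))" for k
    using assms PInf tendsto_pressure_slope_infinity(3) by (intro mult_nonneg_nonneg) (auto simp: pressure_deriv_eq)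
  ultimately show ?thesis by blast
next
  case MInf
  have "filterlim (\<lambda>k. - real k) at_bot sequentially"
    by (simp add: filterlim_uminus_at_bot filterlim_real_sequentially)
  from filterlim_compose[OF tendsto_pressure_slope_infinity(2) this]
  have "(\<lambda>k. pressure_slope (- real k)) \<longlonglongrightarrow> \<alpha>"
    using assms MInf by (simp add: pressure_deriv_eq)
  moreover have "0 \<le> - real k * (\<alpha> - pressure_slope (- real k))" for k
    using assms MInf tendsto_pressure_slope_infinity(4) by (intro mult_nonpos_nonpos) (auto simp: pressure_deriv_eq)
  ultimately show ?thesis by (intro exI[of _ "\<lambda>k. - real k"]) auto
qed

lemma level_set_pressure_deriv:
  assumes "\<alpha> = pressure_deriv m l q \<phi> t"
  shows "level_set m l q \<phi> \<alpha> \<noteq> {}"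
    and "hausdorff_dim (seq_space m) (seq_dist m) (level_set m l q \<phi> \<alpha>) =
       pressure_conj m l q \<phi> \<alpha> / ereal (real q ^ (l - 1) * ln (real m))"
proof -
  obtain s where s: "(\<lambda>k. pressure_slope (s k)) \<longlonglongrightarrow> \<alpha>" "\<And>k::nat. 0 \<le> s k * (\<alpha> - pressure_slope (s k))"
    using pressure_deriv_sequence[OF assms] by blast
  show nonempty: "level_set m l q \<phi> \<alpha> \<noteq> {}" by (rule level_set_limit_slope(1)[OF s])
  define c where "c = real q ^ (l - 1) * ln (real m)"
  define d where "d = hausdorff_dim (seq_space m) (seq_dist m) (level_set m l q \<phi> \<alpha>)"
  have c: "c > 0" using q_ge_2 m_ge_2 by (simp add: c_def)
  have divide: "ereal y / ereal c = ereal (y / c)" for y using c by simp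
  have conj_le: "pressure_conj m l q \<phi> \<alpha> \<le> ereal (P t - t * \<alpha>)" for t
    unfolding pressure_conj_def by (rule INF_lower2[of t]) auto
  have "0 \<le> pressure_conj m l q \<phi> \<alpha>"
    unfolding pressure_conj_def using nonempty pressure_minus_nonneg by (intro INF_greatest) auto
  then obtain D where D: "pressure_conj m l q \<phi> \<alpha> = ereal D"
    using conj_le[of 0] by (cases "pressure_conj m l q \<phi> \<alpha>") auto
  show "d = pressure_conj m l q \<phi> \<alpha> / ereal c"
  proof (rule antisym)
    have "ereal c * d \<le> pressure_conj m l q \<phi> \<alpha>"
      unfolding pressure_conj_def
    proof (rule INF_greatest)
      fix t
      have "d \<le> ereal (P t - t * \<alpha>) / ereal c"
        unfolding divide unfolding d_def c_def by (rule level_set_dim_le[OF nonempty])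
      then have "ereal c * d \<le> ereal (P t - t * \<alpha>)"
        using c by (subst (asm) ereal_le_divide_pos) auto
      then show "ereal c * d \<le> ereal (- t * \<alpha> + P t)" by simp
    qed
    then show "d \<le> pressure_conj m l q \<phi> \<alpha> / ereal c"
      using c by (simp add: ereal_le_divide_pos)
    have "ereal (D / c) \<le> d"
      unfolding c_def d_def using conj_le D by (intro level_set_limit_slope(2)[OF s]) auto
    then show "pressure_conj m l q \<phi> \<alpha> / ereal c \<le> d" unfolding D divide .
  qed
qed

text \<open>For a point of the level set, \<open>0 \<le> P(t) - t \<alpha>\<close>, whereas \<open>P(t)\<close> is at most \<open>P(0) + t\<close> times the slope
at \<open>t\<close>. Letting \<open>t\<close> tend to \<open>\<plusminus>\<infinity>\<close> keeps \<open>\<alpha>\<close> between the limits of the slope.\<close>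

lemma nonempty_level_set_bounds:
  assumes "level_set m l q \<phi> \<alpha> \<noteq> {}"
  shows "(INF s. pressure_slope s) \<le> \<alpha>" "\<alpha> \<le> (SUP s. pressure_slope s)"
proof -
  have grow: "t * (\<alpha> - pressure_slope t) \<le> P 0" for t
    using assms pressure_minus_nonneg[of _ \<alpha> t] pressure_slope_subgradient[of t 0]
    by (auto simp: algebra_simps)
  show "\<alpha> \<le> (SUP s. pressure_slope s)"
  proof (rule ccontr)
    assume "\<not> ?thesis"
    then have gap: "\<alpha> - (SUP s. pressure_slope s) > 0" by simp
    obtain t where t: "P 0 < real t * (\<alpha> - (SUP s. pressure_slope s))" using reals_Archimedean3[OF gap] by blast
    also have "\<dots> \<le> real t * (\<alpha> - pressure_slope (real t))"
      using tendsto_pressure_slope_infinity(3) by (intro mult_left_mono diff_mono) auto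
    finally show False using grow[of "real t"] by simp
  qed
  show "(INF s. pressure_slope s) \<le> \<alpha>"
  proof (rule ccontr)
    assume "\<not> ?thesis"
    then have gap: "(INF s. pressure_slope s) - \<alpha> > 0" by simp
    obtain t where t: "P 0 < real t * ((INF s. pressure_slope s) - \<alpha>)" using reals_Archimedean3[OF gap] by blast
    also have "\<dots> \<le> real t * (pressure_slope (- real t) - \<alpha>)"
      using tendsto_pressure_slope_infinity(4) by (intro mult_left_mono diff_mono) auto
    finally show False using grow[of "- real t"] by (simp add: algebra_simps)
  qed
qed

lemma nonempty_level_sets:
  "{\<alpha>. level_set m l q \<phi> \<alpha> \<noteq> {}} = {pressure_deriv m l q \<phi> (-\<infinity>) .. pressure_deriv m l q \<phi> \<infinity>}"
proof (intro equalityI subsetI)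
  fix \<alpha> assume "\<alpha> \<in> {\<alpha>. level_set m l q \<phi> \<alpha> \<noteq> {}}"
  then show "\<alpha> \<in> {pressure_deriv m l q \<phi> (-\<infinity>) .. pressure_deriv m l q \<phi> \<infinity>}"
    using nonempty_level_set_bounds[of \<alpha>] by (simp add: pressure_deriv_eq)
next
  fix \<alpha> assume \<alpha>: "\<alpha> \<in> {pressure_deriv m l q \<phi> (-\<infinity>) .. pressure_deriv m l q \<phi> \<infinity>}"
  have "\<exists>t. \<alpha> = pressure_deriv m l q \<phi> t"
  proof (cases "\<alpha> = pressure_deriv m l q \<phi> (-\<infinity>) \<or> \<alpha> = pressure_deriv m l q \<phi> \<infinity>")
    case False
    then have strict: "(INF s. pressure_slope s) < \<alpha>" "\<alpha> < (SUP s. pressure_slope s)"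
      using \<alpha> by (auto simp: pressure_deriv_eq)
    obtain a where a: "pressure_slope a < \<alpha>"
      using order_tendstoD(2)[OF tendsto_pressure_slope_infinity(2) strict(1)]
      by (auto simp: eventually_at_bot_linorder)
    obtain b where b: "\<alpha> < pressure_slope b"
      using order_tendstoD(1)[OF tendsto_pressure_slope_infinity(1) strict(2)]
      by (auto simp: eventually_at_top_linorder)
    have "a \<le> b" using a b pressure_slope_mono[of b a] by (cases "a \<le> b") auto
    moreover have "continuous_on {a..b} pressure_slope"
      using tendsto_pressure_slope by (intro continuous_at_imp_continuous_on) (auto simp: isCont_def)
    ultimately obtain t where "pressure_slope t = \<alpha>"
      using IVT'[of pressure_slope a \<alpha> b] a b by auto
    then show ?thesis by (intro exI[of _ "ereal t"]) (simp add: pressure_deriv_eq)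
  qed auto
  then show "\<alpha> \<in> {\<alpha>. level_set m l q \<phi> \<alpha> \<noteq> {}}" using level_set_pressure_deriv(1) by auto
qed

end

theorem theorem1p1:
  fixes m l q :: nat and \<phi> :: "nat list \<Rightarrow> real"
  assumes "m \<ge> 2" and "l \<ge> 2" and "q \<ge> 2"
    and "Min (\<phi> ` words m l) < Max (\<phi> ` words m l)"
  shows "{\<alpha>. level_set m l q \<phi> \<alpha> \<noteq> {}} =
           {pressure_deriv m l q \<phi> (-\<infinity>) .. pressure_deriv m l q \<phi> \<infinity>}
         \<and> (\<forall>(\<alpha>::real) (s::ereal). \<alpha> = pressure_deriv m l q \<phi> s \<longrightarrow>
              level_set m l q \<phi> \<alpha> \<noteq> {} \<and>
              hausdorff_dim (seq_space m) (seq_dist m) (level_set m l q \<phi> \<alpha>) =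
                pressure_conj m l q \<phi> \<alpha> / ereal (real q ^ (l - 1) * ln (real m)))"
proof -
  interpret multiple_average m l q \<phi> using assms by unfold_locales
  show ?thesis using nonempty_level_sets level_set_pressure_deriv by blast
qed

end
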